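(* Let $n\ge1$. For any $\nu>1$ there exist constants $C>0$ and $0<\eta_0<1$ such that for any real number $0<\eta\le\eta_0$, any real number $0<\alpha\le2$, any real number $R\ge1$ and any $V\in\mathcal L(\mathbb C^n)$, the lower bound $$V(z)\ \ge\ \max_{\mathbb B_R}V-\nu\log(C/\eta)$$ holds for any $z\in\mathbb B_R$ outside the union of a countable family of Euclidean balls of radii $(r_j)$ less than $\eta R$ which satisfy $$\sum_j r_j^{2n-2+\alpha}<9^{n-1}R^{2n-2+\alpha}\,\eta^{\alpha}/\alpha.$$
   Context: $\mathbb B_R$ is the Euclidean ball of radius $R$ centered at the origin of $\mathbb C^n$; $\max_{\mathbb B_R}V$ denotes the supremum of $V$ on $\mathbb B_R$ (the maximum over the closed ball). $PSH(\mathbb C^n)$ is the set of plurisubharmonic functions on $\mathbb C^n$ that are not identically $-\infty$, and the Lelong class is $\mathcal L(\mathbb C^n):=\{v\in PSH(\mathbb C^n):\ v(z)\le\log^+|z|+O(1)\ \forall z\in\mathbb C^n\}$. *)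

theory Defs
  imports "HOL-Analysis.Analysis"
begin

text \<open>
  Subharmonic and plurisubharmonic functions take values in \<open>[-\<infinity>, \<infinity>)\<close> and are modelled as
  functions into \<^typ>\<open>ereal\<close> that avoid \<open>\<infinity>\<close>.
\<close>

definition usc :: "('a::topological_space \<Rightarrow> ereal) \<Rightarrow> bool" where
  "usc f \<longleftrightarrow> (\<forall>c. open {x. f x < c})"

text \<open>
  The integral mean is the Lebesgue integral of the positive part minus that of the negative part
  (\<^const>\<open>e2ennreal\<close> sends negative values to \<open>0\<close>). For an upper semicontinuous function without
  the value \<open>\<infinity>\<close> the first integral is finite, so the mean is always a meaningful element of
  \<open>[-\<infinity>, \<infinity>)\<close>. The Bochner integral would instead return \<open>0\<close> when the mean is \<open>-\<infinity>\<close>.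
\<close>
definition circle_mean :: "(complex \<Rightarrow> ereal) \<Rightarrow> complex \<Rightarrow> real \<Rightarrow> ereal" where
  "circle_mean f a r =
     (enn2ereal (\<integral>\<^sup>+\<theta>\<in>{0..2*pi}. e2ennreal (f (a + of_real r * cis \<theta>)) \<partial>lborel)
      - enn2ereal (\<integral>\<^sup>+\<theta>\<in>{0..2*pi}. e2ennreal (- f (a + of_real r * cis \<theta>)) \<partial>lborel))
     / ereal (2 * pi)"

text \<open>
  Subharmonicity on the whole plane. The constant function \<open>-\<infinity>\<close> is admitted here.
\<close>
definition subharmonic :: "(complex \<Rightarrow> ereal) \<Rightarrow> bool" where
  "subharmonic f \<longleftrightarrow>
     usc f \<and> (\<forall>a. f a < \<infinity>) \<and> (\<forall>a r. 0 < r \<longrightarrow> f a \<le> circle_mean f a r)"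

text \<open>
  \<open>\<complex>\<^sup>n\<close> is \<^typ>\<open>complex ^ 'n\<close> with \<open>n = CARD('n)\<close>; its norm is the Euclidean one.
  Plurisubharmonic: upper semicontinuous and, on every complex line, subharmonic or identically
  \<open>-\<infinity>\<close>; the function that is \<open>-\<infinity>\<close> everywhere is excluded.
\<close>
definition PSH :: "((complex ^ 'n) \<Rightarrow> ereal) set" where
  "PSH = {u. usc u \<and> (\<forall>z. u z < \<infinity>)
           \<and> (\<forall>a b. subharmonic (\<lambda>t. u (a + t *s b)))
           \<and> (\<exists>z. u z \<noteq> -\<infinity>)}"

definition log_plus :: "real \<Rightarrow> real" where
  "log_plus x = ln (max 1 x)"

definition lelong_class :: "((complex ^ 'n) \<Rightarrow> ereal) set" where
  "lelong_class = {v \<in> PSH. \<exists>M::real. \<forall>z. v z \<le> ereal (log_plus (norm z) + M)}"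

end

theory Submission
  imports Defs
begin

text \<open>
  Rescaling reduces the statement to \<open>R = 1\<close>. Replacing \<open>V\<close> by its maximum with a constant just
  below the lower bound to be proved changes neither the points where the bound holds nor the
  maximum over the ball; so \<open>V\<close> may be taken real valued and bounded below. Call the resulting
  plurisubharmonic function \<open>v\<close>.

  Averages of \<open>v\<close> around a point \<open>a\<close> against the radial kernels \<open>K\<^sub>r\<close> (\<open>mean_kernel\<close>, normalised to mass \<open>1\<close>)
  increase with \<open>r\<close>, and by upper semicontinuity their limit as \<open>r\<close> tends to \<open>0\<close> is at most \<open>v a\<close>.
  Their derivative in \<open>r\<close> is, up to a constant and a power of \<open>r\<close>, the integral \<open>T(a, r)\<close> (\<open>riesz_mass\<close>) of a
  bump supported in the ball of radius \<open>r\<close> around \<open>a\<close> against the Riesz measure \<open>\<Delta>v\<close>. Suppose that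
  \<open>a\<close> satisfies the growth condition \<open>T(a, r) \<le> A r\<^bsup>2n-2+\<alpha>\<^esup>\<close> (for the bump rescaled to height \<open>1\<close>)
  at all scales \<open>r \<le> \<delta>\<close>. Integrating the derivative from \<open>0\<close> to \<open>\<delta>\<close> shows that \<open>v a\<close> lies below its average at
  scale \<open>\<delta>\<close> by at most a multiple of \<open>A \<delta>\<^sup>\<alpha> / \<alpha>\<close> (\<open>lower_bound_of_riesz_mass_decay\<close>).

  The points of the unit ball that violate the growth condition at some scale are covered, by Vitali's lemma, by the
  fivefold enlargements of disjoint balls on each of which \<open>T > A r\<^bsup>2n-2+\<alpha>\<^esup>\<close>. Disjoint balls carry at
  most the mass of one fixed larger ball, and that mass is bounded by a constant depending only on
  the dimension. Hence the sum of the \<open>r\<^bsup>2n-2+\<alpha>\<^esup>\<close> is \<open>O(1/A)\<close> (\<open>exceptional_balls\<close>).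

  The average at scale \<open>\<delta>\<close> is at least \<open>max v - log (1/\<delta>) - O(1)\<close>: the Bernstein-Walsh
  inequality \<open>v z \<le> max\<^bsub>B(a,r)\<^esub> v + log\<^sup>+ (|z - a| / r)\<close> transports the maximum over the unit ball to
  the ball of radius \<open>\<delta>\<close> around \<open>a\<close>, and near a maximum point the sub-mean value property prevents \<open>v\<close>
  from being small on average. It remains to take \<open>\<delta> = \<eta>/10\<close> and to choose \<open>A\<close> so that the loss
  \<open>A \<delta>\<^sup>\<alpha> / \<alpha>\<close> equals \<open>(\<nu> - 1) log (1/\<delta>)\<close>. Then \<open>1/A\<close> is a multiple of
  \<open>\<delta>\<^sup>\<alpha> / (\<alpha> (\<nu> - 1) log (1/\<delta>))\<close>, and the logarithm beats every dimensional constant once \<open>\<eta>\<close> is small.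

  Positivity of the Riesz measure is used in the form \<open>circle_laplacian_nonneg\<close>: the
  integral of \<open>v\<close> against the Laplacian of a nonnegative test function is nonnegative. Sub-mean inequalities
  over small circles in the coordinate directions, integrated against the test function, give it in the
  limit of radius \<open>0\<close>. All test functions are combinations of \<open>max 0 (r\<^sup>2 - |x - a|\<^sup>2)\<^sup>3\<close>,
  whose circle means have an explicit Taylor expansion.
\<close>

section \<open>Lebesgue measure and circle integrals\<close>

lemma nn_integral_lborel_shift:
  fixes f :: "'a::euclidean_space \<Rightarrow> ennreal"
  assumes [measurable]: "f \<in> borel_measurable borel"
  shows "(\<integral>\<^sup>+x. f (x + c) \<partial>lborel) = (\<integral>\<^sup>+x. f x \<partial>lborel)"
proof -
  have "(\<integral>\<^sup>+x. f x \<partial>lborel) = (\<integral>\<^sup>+x. f x \<partial>(distr lborel borel ((+) c)))"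
    by (simp add: lborel_distr_plus)
  also have "\<dots> = (\<integral>\<^sup>+x. f (c + x) \<partial>lborel)" by (subst nn_integral_distr) auto
  finally show ?thesis by (simp add: add.commute)
qed

lemma integral_lborel_shift:
  fixes f :: "'a::euclidean_space \<Rightarrow> real"
  assumes [measurable]: "f \<in> borel_measurable borel"
  shows "(\<integral>x. f (x + c) \<partial>lborel) = (\<integral>x. f x \<partial>lborel)"
proof -
  have "(\<integral>x. f x \<partial>lborel) = (\<integral>x. f x \<partial>(distr lborel borel ((+) c)))"
    by (simp add: lborel_distr_plus)
  also have "\<dots> = (\<integral>x. f (c + x) \<partial>lborel)" by (subst integral_distr) auto
  finally show ?thesis by (simp add: add.commute)
qed

text \<open>
  The argument for uniqueness of Haar measure: for the indicator \<open>ind\<close> of the unit ball, which \<open>T\<close>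
  preserves, the double integral of \<open>f (T x) * ind y\<close> is transformed by two translations into that of
  \<open>f y * ind x\<close>.
\<close>
lemma lborel_distr_linear_isometry:
  fixes T :: "'a::euclidean_space \<Rightarrow> 'a"
  assumes lin: "linear T" and iso: "\<And>x. norm (T x) = norm x"
  shows "distr lborel borel T = lborel"
proof (rule measure_eqI)
  show "sets (distr lborel borel T) = sets lborel" by simp
next
  fix E assume "E \<in> sets (distr lborel borel T)"
  hence E[measurable]: "E \<in> sets borel" by simp
  have cont: "continuous_on UNIV T"
    using lin linear_continuous_on linear_conv_bounded_linear by blast
  have T[measurable]: "T \<in> borel_measurable borel"
    using cont borel_measurable_continuous_onI by blast
  have "inj T" using lin iso by (metis linear_injective_0 norm_eq_zero)
  hence "surj T" using lin linear_injective_imp_surjective by blast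
  then obtain S where S: "\<And>y. T (S y) = y" by (metis surj_def)
  define ind :: "'a \<Rightarrow> ennreal" where "ind = indicator (ball 0 1)"
  define f :: "'a \<Rightarrow> ennreal" where "f = indicator E"
  have [measurable]: "ind \<in> borel_measurable borel" "f \<in> borel_measurable borel"
    unfolding ind_def f_def by (intro borel_measurable_indicator; simp)+
  have sym: "ind (-x) = ind x" "ind (T x) = ind x" for x
    by (auto simp: ind_def indicator_def iso)
  let ?V = "\<integral>\<^sup>+y. ind y \<partial>lborel"
  have V: "?V = emeasure lborel (ball (0::'a) 1)" by (simp add: ind_def)
  have Vfin: "?V \<noteq> \<infinity>"
    unfolding V using emeasure_lborel_ball_finite[of "0::'a" 1] by simp
  have V0: "?V \<noteq> 0"
    unfolding V using content_ball_pos[of 1 "0::'a"]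
    by (simp add: measure_def) (metis enn2real_0 less_irrefl)
  have "(\<integral>\<^sup>+x. f (T x) \<partial>lborel) * ?V = (\<integral>\<^sup>+x. (\<integral>\<^sup>+y. f (T x) * ind y \<partial>lborel) \<partial>lborel)"
    by (simp add: nn_integral_multc nn_integral_cmult)
  also have "\<dots> = (\<integral>\<^sup>+x. (\<integral>\<^sup>+y. f (T x) * ind (y + - T x) \<partial>lborel) \<partial>lborel)"
    by (intro nn_integral_cong nn_integral_lborel_shift[symmetric]) measurable
  also have "\<dots> = (\<integral>\<^sup>+y. (\<integral>\<^sup>+x. f (T x) * ind (y + - T x) \<partial>lborel) \<partial>lborel)"
    by (rule lborel_pair.Fubini') measurable
  also have "\<dots> = (\<integral>\<^sup>+y. (\<integral>\<^sup>+x. f (T (x + S y)) * ind (y + - T (x + S y)) \<partial>lborel) \<partial>lborel)"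
    by (intro nn_integral_cong nn_integral_lborel_shift[symmetric]) measurable
  also have "\<dots> = (\<integral>\<^sup>+y. (\<integral>\<^sup>+x. f (y + T x) * ind x \<partial>lborel) \<partial>lborel)"
    using sym by (intro nn_integral_cong) (simp add: linear_add[OF lin] S add.commute)
  also have "\<dots> = (\<integral>\<^sup>+x. (\<integral>\<^sup>+y. f (y + T x) * ind x \<partial>lborel) \<partial>lborel)"
    by (rule lborel_pair.Fubini'[symmetric]) measurable
  also have "\<dots> = (\<integral>\<^sup>+x. (\<integral>\<^sup>+y. f y * ind x \<partial>lborel) \<partial>lborel)"
    by (intro nn_integral_cong nn_integral_lborel_shift[where f="\<lambda>y. f y * ind _"]) measurable
  also have "\<dots> = (\<integral>\<^sup>+y. f y \<partial>lborel) * ?V"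
    by (simp add: nn_integral_multc nn_integral_cmult)
  finally have "(\<integral>\<^sup>+x. f (T x) \<partial>lborel) = (\<integral>\<^sup>+y. f y \<partial>lborel)"
    using Vfin V0 by (simp add: ennreal_mult_cancel_left mult.commute[of _ ?V])
  moreover have "(\<integral>\<^sup>+x. f x \<partial>distr lborel borel T) = (\<integral>\<^sup>+x. f (T x) \<partial>lborel)"
    by (subst nn_integral_distr) auto
  ultimately show "emeasure (distr lborel borel T) E = emeasure lborel E"
    by (simp add: f_def)
qed

lemma integrable_bounded_support:
  fixes f :: "'a::euclidean_space \<Rightarrow> real"
  assumes "f \<in> borel_measurable borel" and "\<And>x. \<bar>f x\<bar> \<le> B" and "\<And>x. x \<notin> cball a R \<Longrightarrow> f x = 0"
  shows "integrable lborel f"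
  using assms emeasure_lborel_cball_finite[of a R]
  by (intro integrableI_bounded_set[where A="cball a R" and B=B]) auto

lemma integrable_bounded_support_pair:
  fixes f :: "real \<times> 'a::euclidean_space \<Rightarrow> real"
  assumes "f \<in> borel_measurable borel" and "\<And>t x. \<bar>f (t, x)\<bar> \<le> B"
    and "\<And>t x. t \<notin> {c..d} \<Longrightarrow> f (t, x) = 0" and "\<And>t x. x \<notin> cball a R \<Longrightarrow> f (t, x) = 0"
  shows "integrable (lborel \<Otimes>\<^sub>M lborel) f"
proof (rule integrableI_bounded_set[where A="{c..d} \<times> cball a R" and B=B])
  show "{c..d} \<times> cball a R \<in> sets (lborel \<Otimes>\<^sub>M lborel)" by simp
  show "f \<in> borel_measurable (lborel \<Otimes>\<^sub>M lborel)" using assms(1) by (simp add: lborel_prod)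
  show "emeasure (lborel \<Otimes>\<^sub>M lborel) ({c..d} \<times> cball a R) < \<infinity>"
    using emeasure_lborel_cball_finite[of a R]
    using emeasure_lborel_cbox_finite[of c d]
    by (subst lborel.emeasure_pair_measure_Times) (auto simp: ennreal_mult_less_top)
qed (use assms in \<open>auto simp: mem_Times_iff\<close>)

lemma norm_scalar_mult: "norm (c *s (x :: complex ^ 'n)) = norm c * norm x"
  by (simp add: norm_vec_def L2_set_def norm_mult power_mult_distrib sum_distrib_left[symmetric] real_sqrt_mult)

lemma norm_axis_vec: "norm (axis j c :: complex ^ 'n) = norm c"
  by (simp add: norm_eq_sqrt_inner inner_axis_axis)

lemma continuous_on_scalar_mult [continuous_intros]:
  fixes g :: "'a::topological_space \<Rightarrow> complex ^ 'n"
  assumes "continuous_on S f" "continuous_on S g"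
  shows "continuous_on S (\<lambda>x. f x *s g x)"
  unfolding vector_scalar_mult_def using assms
  by (intro continuous_on_vec_lambda continuous_intros) auto

lemma measurable_cis [measurable]: "cis \<in> borel_measurable borel"
  by (intro borel_measurable_continuous_onI continuous_intros)

lemma set_integral_FTC:
  fixes F :: "real \<Rightarrow> real"
  assumes "a \<le> b" "\<And>x. a \<le> x \<Longrightarrow> x \<le> b \<Longrightarrow> (F has_real_derivative f x) (at x)"
    "continuous_on {a..b} f"
  shows "(LINT x:{a..b}|lborel. f x) = F b - F a"
  unfolding set_lebesgue_integral_def
  using assms by (intro integral_FTC_atLeastAtMost)
    (auto intro: has_field_derivative_at_within simp flip: has_real_derivative_iff_has_vector_derivative)

lemma set_integrable_circle:
  fixes f :: "real \<Rightarrow> real"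
  assumes "continuous_on UNIV f" shows "set_integrable lborel {0..2*pi} f"
  using assms by (intro borel_integrable_atLeastAtMost') (auto intro: continuous_on_subset)

lemma circle_integral_Re:
  "(LINT \<theta>:{0..2*pi}|lborel. Re (w * cis \<theta>)) = 0"
proof -
  have "(LINT \<theta>:{0..2*pi}|lborel. Re (w * cis \<theta>)) =
     (Re w * sin (2*pi) + Im w * cos (2*pi)) - (Re w * sin 0 + Im w * cos 0)"
    by (rule set_integral_FTC[where F="\<lambda>\<theta>. Re w * sin \<theta> + Im w * cos \<theta>"])
       (auto intro!: derivative_eq_intros continuous_intros)
  thus ?thesis by simp
qed

lemma circle_integral_Re_squared:
  "(LINT \<theta>:{0..2*pi}|lborel. (Re (w * cis \<theta>))\<^sup>2) = pi * (cmod w)\<^sup>2"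
proof -
  define p q where "p = Re w" and "q = Im w"
  define F where "F = (\<lambda>\<theta>. p\<^sup>2 * (\<theta> + sin \<theta> * cos \<theta>) / 2 + q\<^sup>2 * (\<theta> - sin \<theta> * cos \<theta>) / 2 - p * q * (sin \<theta>)\<^sup>2)"
  have "(LINT \<theta>:{0..2*pi}|lborel. (Re (w * cis \<theta>))\<^sup>2) = F (2*pi) - F 0"
  proof (rule set_integral_FTC)
    fix t :: real
    have *: "(F has_real_derivative (p\<^sup>2 * (1 + (cos t)\<^sup>2 - (sin t)\<^sup>2) / 2 + q\<^sup>2 * (1 - (cos t)\<^sup>2 + (sin t)\<^sup>2) / 2 - 2 * p * q * sin t * cos t)) (at t)"
      unfolding F_def by (auto intro!: derivative_eq_intros simp: power2_eq_square algebra_simps add_divide_distrib diff_divide_distrib)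
    have "(Re (w * cis t))\<^sup>2 = (p * cos t - q * sin t)\<^sup>2" by (simp add: p_def q_def)
    also have "\<dots> = p\<^sup>2 * (cos t)\<^sup>2 + q\<^sup>2 * (sin t)\<^sup>2 - 2 * p * q * sin t * cos t" by (simp add: power2_eq_square algebra_simps)
    also have "\<dots> = p\<^sup>2 * (1 + (cos t)\<^sup>2 - (sin t)\<^sup>2) / 2 + q\<^sup>2 * (1 - (cos t)\<^sup>2 + (sin t)\<^sup>2) / 2 - 2 * p * q * sin t * cos t"
      using sin_cos_squared_add[of t] by (simp add: cos_squared_eq field_simps)
    finally show "(F has_real_derivative (Re (w * cis t))\<^sup>2) (at t)" using * by simp
  qed (auto intro!: continuous_intros)
  also have "\<dots> = pi * (p\<^sup>2 + q\<^sup>2)" by (simp add: F_def algebra_simps)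
  finally show ?thesis by (simp add: p_def q_def cmod_power2)
qed

lemma circle_integral_const: "(LINT \<theta>:{0..2*pi}|lborel. (c::real)) = 2 * pi * c"
  by (subst set_integral_FTC[where F="\<lambda>\<theta>. c * \<theta>"]) (auto intro!: derivative_eq_intros)

section \<open>Bounded plurisubharmonic functions and their averages\<close>

lemma usc_attains_max:
  fixes f :: "'a::topological_space \<Rightarrow> real"
  assumes K: "compact K" "K \<noteq> {}" and usc: "\<And>c. open {x. f x < c}"
  obtains x where "x \<in> K" "\<And>y. y \<in> K \<Longrightarrow> f y \<le> f x"
proof (rule ccontr)
  assume "\<not> thesis"
  hence "\<forall>x\<in>K. \<exists>y\<in>K. f x < f y" using that by (meson not_le)
  then have "K \<subseteq> (\<Union>y\<in>K. {x. f x < f y})" by auto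
  then obtain C where C: "C \<subseteq> K" "finite C" "K \<subseteq> (\<Union>y\<in>C. {x. f x < f y})"
    using compactE_image[OF K(1), of K "\<lambda>y. {x. f x < f y}"] usc by auto
  hence "C \<noteq> {}" using K by auto
  with C have "Max (f ` C) \<in> f ` C" by (intro Max_in) auto
  then obtain x where x: "x \<in> C" "f x = Max (f ` C)" by auto
  with C obtain y where "y \<in> C" "f x < f y" by blast
  with x C show False by (metis Max_ge finite_imageI image_eqI not_le)
qed

text \<open>
  The circle with centre \<open>a\<close> through \<open>a + b\<close> in the complex line spanned by \<open>b\<close>; letting \<open>b\<close> vary
  covers all radii.
\<close>
locale bounded_psh =
  fixes v :: "complex ^ 'n \<Rightarrow> real"
  assumes open_sublevel: "open {x. v x < c}"
    and bdd_below: "\<exists>c. \<forall>x. c \<le> v x"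
    and circle_submean: "2 * pi * v a \<le> (LINT \<theta>:{0..2*pi}|lborel. v (a + cis \<theta> *s b))"

lemma bounded_psh_const: "bounded_psh (\<lambda>x. c)"
  by unfold_locales (auto simp: circle_integral_const)

context bounded_psh
begin

lemma borel_measurable_psh [measurable]: "v \<in> borel_measurable borel"
  using open_sublevel by (intro borel_measurableI_less) auto

lemma bounded_on_cball: "\<exists>B\<ge>0. \<forall>x\<in>cball a R. \<bar>v x\<bar> \<le> B"
proof (cases "R \<ge> 0")
  case True
  hence "cball a R \<noteq> {}" by simp
  from usc_attains_max[OF compact_cball this, of v] open_sublevel
  obtain x where "\<And>y. y \<in> cball a R \<Longrightarrow> v y \<le> v x" by metis
  moreover obtain c where "\<And>y. c \<le> v y" using bdd_below by auto
  ultimately have "\<bar>v y\<bar> \<le> \<bar>c\<bar> + \<bar>v x\<bar>" if "y \<in> cball a R" for y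
    using that by (smt (verit))
  thus ?thesis by (intro exI[of _ "\<bar>c\<bar> + \<bar>v x\<bar>"]) auto
qed auto

lemma integrable_weighted:
  assumes [measurable]: "\<phi> \<in> borel_measurable borel" and "\<And>x. \<bar>\<phi> x\<bar> \<le> B" and "\<And>x. x \<notin> cball a R \<Longrightarrow> \<phi> x = 0"
  shows "integrable lborel (\<lambda>x. \<phi> x * v x)"
proof -
  obtain D where D: "D \<ge> 0" "\<And>x. x \<in> cball a R \<Longrightarrow> \<bar>v x\<bar> \<le> D" using bounded_on_cball by blast
  have "\<bar>\<phi> x * v x\<bar> \<le> B * D" for x
  proof (cases "x \<in> cball a R")
    case True thus ?thesis using assms(2)[of x] D by (auto simp: abs_mult intro!: mult_mono)
  next
    case False thus ?thesis using assms(3)[of x] assms(2)[of x] D(1) by simp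
  qed
  thus ?thesis using assms(3) by (intro integrable_bounded_support[where a=a and R=R and B="B*D"]) auto
qed

text \<open>
  The two instances of interest have constant \<open>A\<close> with \<open>B\<close> the identity, which averages over balls, and \<open>A\<close> the
  identity with constant \<open>B\<close>, which tests the sub-mean inequality at all points against \<open>\<phi>\<close>.
\<close>
lemma weighted_circle_submean:
  fixes A B :: "complex ^ 'n \<Rightarrow> complex ^ 'n"
  assumes [measurable]: "\<phi> \<in> borel_measurable borel" and bd: "\<And>x. \<bar>\<phi> x\<bar> \<le> D" and supp: "\<And>x. x \<notin> cball 0 R \<Longrightarrow> \<phi> x = 0"
    and nonneg: "\<And>x. \<phi> x \<ge> 0"
    and A: "continuous_on UNIV A" and B: "continuous_on UNIV B"
  shows "2 * pi * (\<integral>x. \<phi> x * v (A x) \<partial>lborel)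
     \<le> (LINT \<theta>:{0..2*pi}|lborel. (\<integral>x. \<phi> x * v (A x + cis \<theta> *s B x) \<partial>lborel))"
proof -
  have [measurable]: "A \<in> borel_measurable borel" "B \<in> borel_measurable borel"
    using A B by (auto intro: borel_measurable_continuous_onI)
  have "compact ((\<lambda>p. A (snd p) + cis (fst p) *s B (snd p)) ` ({0..2*pi} \<times> cball 0 R))"
    by (intro compact_continuous_image compact_Times continuous_intros)
       (auto intro!: continuous_on_compose2[OF A] continuous_on_compose2[OF B] continuous_intros)
  then obtain R' where R': "\<And>\<theta> x. \<theta> \<in> {0..2*pi} \<Longrightarrow> x \<in> cball 0 R \<Longrightarrow> A x + cis \<theta> *s B x \<in> cball 0 R'"
    by (force dest!: compact_imp_bounded simp: bounded_iff)
  have "compact (A ` cball 0 R)" using A by (intro compact_continuous_image) (auto intro: continuous_on_subset)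
  then obtain R1 where R1: "\<And>x. x \<in> cball 0 R \<Longrightarrow> A x \<in> cball 0 R1"
    by (force dest!: compact_imp_bounded simp: bounded_iff)
  obtain D' where D': "D' \<ge> 0" "\<And>x. x \<in> cball 0 R' \<Longrightarrow> \<bar>v x\<bar> \<le> D'" using bounded_on_cball by blast
  obtain D1 where D1: "D1 \<ge> 0" "\<And>x. x \<in> cball 0 R1 \<Longrightarrow> \<bar>v x\<bar> \<le> D1" using bounded_on_cball by blast
  have D0: "D \<ge> 0" using bd[of 0] by linarith
  let ?F = "\<lambda>(\<theta>, x). indicator {0..2*pi} \<theta> * (\<phi> x * v (A x + cis \<theta> *s B x))"
  have m: "(\<lambda>p. A (snd p) + cis (fst p) *s B (snd p)) \<in> borel_measurable borel"
    by (intro borel_measurable_continuous_onI continuous_intros)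
       (auto intro!: continuous_on_compose2[OF A] continuous_on_compose2[OF B] continuous_intros)
  hence m': "(\<lambda>p. v (A (snd p) + cis (fst p) *s B (snd p))) \<in> borel_measurable borel"
    by (rule measurable_compose) measurable
  have mF: "?F \<in> borel_measurable borel"
    unfolding case_prod_beta using m' unfolding borel_prod[symmetric] by measurable
  have int: "integrable (lborel \<Otimes>\<^sub>M lborel) ?F"
  proof (rule integrable_bounded_support_pair[where c=0 and d="2*pi" and a=0 and R=R and B="D * D'"])
    show "?F \<in> borel_measurable borel" by (fact mF)
    show "\<bar>?F (t, x)\<bar> \<le> D * D'" for t x
    proof (cases "t \<in> {0..2*pi} \<and> x \<in> cball 0 R")
      case True thus ?thesis using bd[of x] D'(2)[OF R'] D0 by (auto simp: abs_mult intro!: mult_mono)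
    next
      case False thus ?thesis using supp[of x] D0 D'(1) by (auto simp: indicator_def)
    qed
  qed (use supp in auto)
  have int1: "integrable lborel (\<lambda>x. \<phi> x * v (A x))"
  proof (rule integrable_bounded_support[where a=0 and R=R and B="D * D1"])
    show "\<bar>\<phi> x * v (A x)\<bar> \<le> D * D1" for x
    proof (cases "x \<in> cball 0 R")
      case True thus ?thesis using bd[of x] D1(2)[OF R1] D0 by (auto simp: abs_mult intro!: mult_mono)
    next
      case False thus ?thesis using supp[of x] D0 D1(1) by auto
    qed
  qed (use supp in auto)
  have "2 * pi * (\<integral>x. \<phi> x * v (A x) \<partial>lborel) = (\<integral>x. \<phi> x * (2 * pi * v (A x)) \<partial>lborel)"
    by (subst integral_mult_right_zero[symmetric]) (simp add: algebra_simps)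
  also have "\<dots> \<le> (\<integral>x. (\<integral>\<theta>. indicator {0..2*pi} \<theta> * (\<phi> x * v (A x + cis \<theta> *s B x)) \<partial>lborel) \<partial>lborel)"
  proof (rule integral_mono)
    show "integrable lborel (\<lambda>x. \<phi> x * (2 * pi * v (A x)))"
      using integrable_mult_right[OF int1, of "2*pi"] by (simp add: algebra_simps)
    show "integrable lborel (\<lambda>x. \<integral>\<theta>. indicator {0..2*pi} \<theta> * (\<phi> x * v (A x + cis \<theta> *s B x)) \<partial>lborel)"
      using lborel_pair.integrable_snd[OF int] .
    fix x
    have "\<phi> x * (2 * pi * v (A x)) \<le> \<phi> x * (LINT \<theta>:{0..2*pi}|lborel. v (A x + cis \<theta> *s B x))"
      using nonneg circle_submean by (intro mult_left_mono) auto
    also have "\<dots> = (\<integral>\<theta>. indicator {0..2*pi} \<theta> * (\<phi> x * v (A x + cis \<theta> *s B x)) \<partial>lborel)"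
      unfolding set_lebesgue_integral_def
      by (subst integral_mult_right_zero[symmetric]) (simp add: mult_ac)
    finally show "\<phi> x * (2 * pi * v (A x)) \<le> \<dots>" .
  qed
  also have "\<dots> = (\<integral>\<theta>. (\<integral>x. indicator {0..2*pi} \<theta> * (\<phi> x * v (A x + cis \<theta> *s B x)) \<partial>lborel) \<partial>lborel)"
    using lborel_pair.Fubini_integral[OF int] .
  also have "\<dots> = (LINT \<theta>:{0..2*pi}|lborel. (\<integral>x. \<phi> x * v (A x + cis \<theta> *s B x) \<partial>lborel))"
    unfolding set_lebesgue_integral_def by simp
  finally show ?thesis .
qed

text \<open>
  Averaging the circle inequality over all \<open>b\<close> gives the inner integral at every rotation angle, and
  that integral does not depend on the angle because multiplication by \<open>cis \<theta>\<close> is an isometry.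
\<close>
lemma radial_submean:
  assumes [measurable]: "\<phi> \<in> borel_measurable borel" and bd: "\<And>x. \<bar>\<phi> x\<bar> \<le> D" and supp: "\<And>x. x \<notin> cball 0 R \<Longrightarrow> \<phi> x = 0"
    and nonneg: "\<And>x. \<phi> x \<ge> 0" and rot: "\<And>\<theta> x. \<phi> (cis \<theta> *s x) = \<phi> x"
  shows "v a * (\<integral>x. \<phi> x \<partial>lborel) \<le> (\<integral>x. \<phi> (x - a) * v x \<partial>lborel)"
proof -
  have *: "(\<integral>x. \<phi> x * v (a + cis \<theta> *s x) \<partial>lborel) = (\<integral>x. \<phi> x * v (a + x) \<partial>lborel)" for \<theta>
  proof -
    let ?T = "\<lambda>x :: complex ^ 'n. cis \<theta> *s x"
    have [measurable]: "?T \<in> borel_measurable borel"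
      by (intro borel_measurable_continuous_onI continuous_intros)
    have "linear ?T" by (intro linearI) (auto simp: vec_eq_iff algebra_simps)
    hence "distr lborel borel ?T = lborel"
      by (rule lborel_distr_linear_isometry) (simp add: norm_scalar_mult)
    hence "(\<integral>x. \<phi> x * v (a + x) \<partial>lborel) = (\<integral>x. \<phi> x * v (a + x) \<partial>distr lborel borel ?T)" by simp
    also have "\<dots> = (\<integral>x. \<phi> (?T x) * v (a + ?T x) \<partial>lborel)"
      by (subst integral_distr) auto
    finally show ?thesis by (simp add: rot)
  qed
  have "2 * pi * (\<integral>x. \<phi> x * v a \<partial>lborel) \<le>
      (LINT \<theta>:{0..2*pi}|lborel. (\<integral>x. \<phi> x * v (a + cis \<theta> *s x) \<partial>lborel))"
    by (rule weighted_circle_submean[OF assms(1-4)]) (auto intro: continuous_intros)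
  also have "\<dots> = 2 * pi * (\<integral>x. \<phi> x * v (a + x) \<partial>lborel)"
    unfolding * by (rule circle_integral_const)
  also have "(\<integral>x. \<phi> x * v (a + x) \<partial>lborel) = (\<integral>x. \<phi> (x - a) * v x \<partial>lborel)"
    using integral_lborel_shift[of "\<lambda>x. \<phi> (x - a) * v x" a] by (simp add: add.commute)
  finally show ?thesis by (simp add: mult.commute)
qed

end

section \<open>Positivity of the Laplacian on test functions\<close>

text \<open>
  Up to a constant factor, \<open>\<Lambda>\<close> is the Laplacian of \<open>\<phi>\<close>: the second-order coefficient of the sum of
  the means of \<open>\<phi>\<close> over circles of radius \<open>\<epsilon>\<close> in the coordinate lines. The remainder is uniform, so
  that it can be integrated against a locally bounded function.
\<close>
definition circle_taylor :: "(complex ^ 'n \<Rightarrow> real) \<Rightarrow> (complex ^ 'n \<Rightarrow> real) \<Rightarrow> bool" where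
  "circle_taylor \<phi> \<Lambda> \<longleftrightarrow> continuous_on UNIV \<phi> \<and> continuous_on UNIV \<Lambda> \<and>
     (\<exists>R. \<forall>x. x \<notin> cball 0 R \<longrightarrow> \<phi> x = 0 \<and> \<Lambda> x = 0) \<and>
     (\<exists>C R. \<forall>\<epsilon> x. 0 < \<epsilon> \<and> \<epsilon> \<le> 1 \<longrightarrow>
        \<bar>(\<Sum>j\<in>UNIV. LINT \<theta>:{0..2*pi}|lborel. \<phi> (x - cis \<theta> *s axis j (of_real \<epsilon>)))
           - 2 * pi * real CARD('n) * \<phi> x - 2 * pi * \<epsilon>\<^sup>2 * \<Lambda> x\<bar>
        \<le> C * \<epsilon> ^ 3 * indicator (cball 0 R) x)"

lemma bounded_compact_support:
  fixes \<phi> :: "complex ^ 'n \<Rightarrow> real"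
  assumes "continuous_on UNIV \<phi>" "\<And>x. x \<notin> cball 0 R \<Longrightarrow> \<phi> x = 0"
  obtains D where "D \<ge> 0" "\<And>x. \<bar>\<phi> x\<bar> \<le> D"
proof -
  have "compact (\<phi> ` cball 0 R)" using assms(1) by (intro compact_continuous_image) (auto intro: continuous_on_subset)
  then obtain D where "\<And>x. x \<in> cball 0 R \<Longrightarrow> \<bar>\<phi> x\<bar> \<le> D"
    by (force dest!: compact_imp_bounded simp: bounded_iff)
  hence "\<bar>\<phi> x\<bar> \<le> max 0 D" for x using assms(2)[of x] by (cases "x \<in> cball 0 R") (auto simp: le_max_iff_disj)
  thus thesis using that[of "max 0 D"] by auto
qed

lemma continuous_circle_shift:
  fixes \<phi> :: "complex ^ 'n \<Rightarrow> real"
  assumes "continuous_on UNIV \<phi>"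
  shows "continuous_on UNIV (\<lambda>\<theta>. \<phi> (x - cis \<theta> *s e))"
  by (rule continuous_on_compose2[OF assms]) (auto intro!: continuous_intros)

lemma circle_taylor_sum:
  fixes \<phi> :: "'i \<Rightarrow> complex ^ 'n \<Rightarrow> real"
  assumes "finite I" "\<And>i. i \<in> I \<Longrightarrow> circle_taylor (\<phi> i) (\<Lambda> i)"
  shows "circle_taylor (\<lambda>x. \<Sum>i\<in>I. c i * \<phi> i x) (\<lambda>x. \<Sum>i\<in>I. c i * \<Lambda> i x)"
  using assms
proof (induction rule: finite_induct)
  case empty
  show ?case by (auto simp: circle_taylor_def circle_integral_const intro!: exI[of _ 0])
next
  case (insert i I)
  let ?f = "\<lambda>x. \<Sum>i\<in>I. c i * \<phi> i x" and ?F = "\<lambda>x. \<Sum>i\<in>I. c i * \<Lambda> i x"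
  let ?M = "\<lambda>\<phi> \<epsilon> x. \<Sum>j\<in>(UNIV::'n set). LINT \<theta>:{0..2*pi}|lborel. \<phi> (x - cis \<theta> *s axis j (of_real \<epsilon>)) :: real"
  have I: "circle_taylor ?f ?F" using insert by auto
  have i: "circle_taylor (\<phi> i) (\<Lambda> i)" using insert by auto
  from I obtain R1 C1 S1 where 1: "continuous_on UNIV ?f" "continuous_on UNIV ?F"
     "\<And>x. x \<notin> cball 0 R1 \<Longrightarrow> ?f x = 0" "\<And>x. x \<notin> cball 0 R1 \<Longrightarrow> ?F x = 0"
     "\<And>\<epsilon> x. 0 < \<epsilon> \<Longrightarrow> \<epsilon> \<le> 1 \<Longrightarrow> \<bar>?M ?f \<epsilon> x - 2 * pi * real CARD('n) * ?f x - 2 * pi * \<epsilon>\<^sup>2 * ?F x\<bar> \<le> C1 * \<epsilon> ^ 3 * indicator (cball 0 S1) x"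
    unfolding circle_taylor_def by blast
  from i obtain R2 C2 S2 where 2: "continuous_on UNIV (\<phi> i)" "continuous_on UNIV (\<Lambda> i)"
     "\<And>x. x \<notin> cball 0 R2 \<Longrightarrow> \<phi> i x = 0" "\<And>x. x \<notin> cball 0 R2 \<Longrightarrow> \<Lambda> i x = 0"
     "\<And>\<epsilon> x. 0 < \<epsilon> \<Longrightarrow> \<epsilon> \<le> 1 \<Longrightarrow> \<bar>?M (\<phi> i) \<epsilon> x - 2 * pi * real CARD('n) * \<phi> i x - 2 * pi * \<epsilon>\<^sup>2 * \<Lambda> i x\<bar> \<le> C2 * \<epsilon> ^ 3 * indicator (cball 0 S2) x"
    unfolding circle_taylor_def by blast
  show ?case unfolding circle_taylor_def sum.insert[OF insert(1,2)]
  proof (intro conjI)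
    show "continuous_on UNIV (\<lambda>x. c i * \<phi> i x + ?f x)" "continuous_on UNIV (\<lambda>x. c i * \<Lambda> i x + ?F x)"
      using 1(1,2) 2(1,2) by (auto intro!: continuous_on_add continuous_on_mult_left)
    show "\<exists>R. \<forall>x. x \<notin> cball 0 R \<longrightarrow> c i * \<phi> i x + ?f x = 0 \<and> c i * \<Lambda> i x + ?F x = 0"
      using 1(3,4) 2(3,4) by (intro exI[of _ "max R1 R2"]) simp
    let ?C = "\<bar>c i\<bar> * \<bar>C2\<bar> + \<bar>C1\<bar>" and ?S = "max S1 S2"
    show "\<exists>C R. \<forall>\<epsilon> x. 0 < \<epsilon> \<and> \<epsilon> \<le> 1 \<longrightarrow>
        \<bar>?M (\<lambda>x. c i * \<phi> i x + ?f x) \<epsilon> x - 2 * pi * real CARD('n) * (c i * \<phi> i x + ?f x)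
          - 2 * pi * \<epsilon>\<^sup>2 * (c i * \<Lambda> i x + ?F x)\<bar> \<le> C * \<epsilon> ^ 3 * indicator (cball 0 R) x"
    proof (rule exI[of _ ?C], rule exI[of _ ?S], intro allI impI)
      fix \<epsilon> :: real and x :: "complex ^ 'n" assume \<epsilon>: "0 < \<epsilon> \<and> \<epsilon> \<le> 1"
      have "?M (\<lambda>x. c i * \<phi> i x + ?f x) \<epsilon> x = (\<Sum>j\<in>UNIV. c i * (LINT \<theta>:{0..2*pi}|lborel. \<phi> i (x - cis \<theta> *s axis j (of_real \<epsilon>)))
           + (LINT \<theta>:{0..2*pi}|lborel. ?f (x - cis \<theta> *s axis j (of_real \<epsilon>))))"
      proof (rule sum.cong[OF refl])
        fix j :: 'n
        note ii = set_integrable_circle[OF continuous_circle_shift[OF 2(1), of x "axis j (of_real \<epsilon>)"]]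
           set_integrable_circle[OF continuous_circle_shift[OF 1(1), of x "axis j (of_real \<epsilon>)"]]
        show "(LINT \<theta>:{0..2*pi}|lborel. c i * \<phi> i (x - cis \<theta> *s axis j (of_real \<epsilon>)) + ?f (x - cis \<theta> *s axis j (of_real \<epsilon>)))
           = c i * (LINT \<theta>:{0..2*pi}|lborel. \<phi> i (x - cis \<theta> *s axis j (of_real \<epsilon>)))
           + (LINT \<theta>:{0..2*pi}|lborel. ?f (x - cis \<theta> *s axis j (of_real \<epsilon>)))"
          using ii by (subst set_integral_add(2)) (auto intro: set_integrable_mult_right)
      qed
      also have "\<dots> = c i * ?M (\<phi> i) \<epsilon> x + ?M ?f \<epsilon> x" by (simp add: sum.distrib sum_distrib_left)
      finally have eq: "?M (\<lambda>x. c i * \<phi> i x + ?f x) \<epsilon> x - 2 * pi * real CARD('n) * (c i * \<phi> i x + ?f x)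
          - 2 * pi * \<epsilon>\<^sup>2 * (c i * \<Lambda> i x + ?F x) = c i * (?M (\<phi> i) \<epsilon> x - 2 * pi * real CARD('n) * \<phi> i x - 2 * pi * \<epsilon>\<^sup>2 * \<Lambda> i x)
          + (?M ?f \<epsilon> x - 2 * pi * real CARD('n) * ?f x - 2 * pi * \<epsilon>\<^sup>2 * ?F x)" by (simp add: algebra_simps)
      have e3: "0 \<le> \<epsilon>^3" using \<epsilon> by simp
      have a1: "\<bar>?M ?f \<epsilon> x - 2 * pi * real CARD('n) * ?f x - 2 * pi * \<epsilon>\<^sup>2 * ?F x\<bar> \<le> \<bar>C1\<bar> * \<epsilon> ^ 3 * indicator (cball 0 ?S) x"
        using 1(5)[of \<epsilon> x] \<epsilon> by (rule_tac order_trans, fast) (intro mult_mono, auto simp: indicator_def)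
      have a2: "\<bar>c i * (?M (\<phi> i) \<epsilon> x - 2 * pi * real CARD('n) * \<phi> i x - 2 * pi * \<epsilon>\<^sup>2 * \<Lambda> i x)\<bar>
          \<le> \<bar>c i\<bar> * (\<bar>C2\<bar> * \<epsilon> ^ 3 * indicator (cball 0 ?S) x)"
        unfolding abs_mult using 2(5)[of \<epsilon> x] \<epsilon>
        by (intro mult_left_mono) (rule order_trans, fast, intro mult_mono, auto simp: indicator_def)
      show "\<bar>?M (\<lambda>x. c i * \<phi> i x + ?f x) \<epsilon> x - 2 * pi * real CARD('n) * (c i * \<phi> i x + ?f x)
          - 2 * pi * \<epsilon>\<^sup>2 * (c i * \<Lambda> i x + ?F x)\<bar> \<le> ?C * \<epsilon> ^ 3 * indicator (cball 0 ?S) x"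
        unfolding eq using a1 a2 by (simp add: algebra_simps) linarith
    qed
  qed
qed

context bounded_psh
begin

text \<open>
  The sub-mean inequality on the circles of radius \<open>\<epsilon>\<close>, integrated against \<open>\<phi>\<close> and with the
  translations moved from \<open>v\<close> to \<open>\<phi>\<close>, says that \<open>v\<close> integrates to a nonnegative number against the
  difference of the circle means of \<open>\<phi>\<close> and \<open>\<phi>\<close> itself. Divide by \<open>\<epsilon>\<^sup>2\<close> and let \<open>\<epsilon>\<close> tend to \<open>0\<close>.
\<close>
lemma circle_laplacian_nonneg:
  assumes ct: "circle_taylor \<phi> \<Lambda>" and nonneg: "\<And>x. 0 \<le> \<phi> x"
  shows "0 \<le> (\<integral>x. \<Lambda> x * v x \<partial>lborel)"
proof -
  let ?M = "\<lambda>\<epsilon> x. \<Sum>j\<in>(UNIV::'n set). LINT \<theta>:{0..2*pi}|lborel. \<phi> (x - cis \<theta> *s axis j (of_real \<epsilon>))"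
  from ct obtain R C S where 1: "continuous_on UNIV \<phi>" "continuous_on UNIV \<Lambda>"
     "\<And>x. x \<notin> cball 0 R \<Longrightarrow> \<phi> x = 0" "\<And>x. x \<notin> cball 0 R \<Longrightarrow> \<Lambda> x = 0"
   and est: "\<And>\<epsilon> x. 0 < \<epsilon> \<Longrightarrow> \<epsilon> \<le> 1 \<Longrightarrow> \<bar>?M \<epsilon> x - 2 * pi * real CARD('n) * \<phi> x - 2 * pi * \<epsilon>\<^sup>2 * \<Lambda> x\<bar> \<le> C * \<epsilon> ^ 3 * indicator (cball 0 S) x"
    unfolding circle_taylor_def by blast
  have [measurable]: "\<phi> \<in> borel_measurable borel" "\<Lambda> \<in> borel_measurable borel"
    using 1 by (auto intro: borel_measurable_continuous_onI)
  obtain D where D: "D \<ge> 0" "\<And>x. \<bar>\<phi> x\<bar> \<le> D" using bounded_compact_support[OF 1(1,3)] by metis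
  obtain D' where D': "D' \<ge> 0" "\<And>x. \<bar>\<Lambda> x\<bar> \<le> D'" using bounded_compact_support[OF 1(2,4)] by metis
  have i\<phi>: "integrable lborel (\<lambda>x. \<phi> x * v x)" using D 1(3) by (intro integrable_weighted[where a=0 and R=R and B=D]) auto
  have i\<Lambda>: "integrable lborel (\<lambda>x. \<Lambda> x * v x)" using D' 1(4) by (intro integrable_weighted[where a=0 and R=R and B=D']) auto
  have iS: "integrable lborel (\<lambda>x. indicator (cball 0 S) x * \<bar>v x\<bar>)"
  proof -
    have "integrable lborel (\<lambda>x. indicator (cball 0 S) x * v x)"
      by (rule integrable_weighted[where a=0 and R=S and B=1]) (auto simp: indicator_def)
    from integrable_abs[OF this] show ?thesis by (simp add: abs_mult)
  qed
  define P where "P = (\<integral>x. indicator (cball 0 S) x * \<bar>v x\<bar> \<partial>lborel)"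
  define I where "I = (\<integral>x. \<Lambda> x * v x \<partial>lborel)"
  have key: "- (C * \<epsilon> * P) \<le> 2 * pi * I" if \<epsilon>: "0 < \<epsilon>" "\<epsilon> \<le> 1" for \<epsilon>
  proof -
    have int: "integrable lborel (\<lambda>x. (LINT \<theta>:{0..2*pi}|lborel. \<phi> (x - cis \<theta> *s e)) * v x)" (is ?int)
     and le: "2 * pi * (\<integral>x. \<phi> x * v x \<partial>lborel) \<le> (\<integral>x. (LINT \<theta>:{0..2*pi}|lborel. \<phi> (x - cis \<theta> *s e)) * v x \<partial>lborel)" (is ?le)
     if e: "norm e \<le> 1" for e :: "complex ^ 'n"
    proof -
      let ?F = "\<lambda>(\<theta>, x). indicator {0..2*pi} \<theta> * (\<phi> (x - cis \<theta> *s e) * v x)"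
      obtain B where B: "B \<ge> 0" "\<And>x. x \<in> cball 0 (R+1) \<Longrightarrow> \<bar>v x\<bar> \<le> B" using bounded_on_cball by blast
      have supp: "\<phi> (x - cis \<theta> *s e) = 0" if "x \<notin> cball 0 (R + 1)" for x \<theta>
      proof (rule 1(3))
        have "norm x \<le> norm (x - cis \<theta> *s e) + norm (cis \<theta> *s e)" by norm
        thus "x - cis \<theta> *s e \<notin> cball 0 R" using that e by (simp add: norm_scalar_mult)
      qed
      have "(\<lambda>p. \<phi> (snd p - cis (fst p) *s e)) \<in> borel_measurable borel"
        by (intro borel_measurable_continuous_onI continuous_on_compose2[OF 1(1)] continuous_intros)
           (auto intro!: continuous_intros)
      hence "?F \<in> borel_measurable borel"
        unfolding case_prod_beta unfolding borel_prod[symmetric] by measurable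
      hence intF: "integrable (lborel \<Otimes>\<^sub>M lborel) ?F"
      proof (rule integrable_bounded_support_pair[where c=0 and d="2*pi" and a=0 and R="R+1" and B="D * B"])
        show "\<bar>?F (t, x)\<bar> \<le> D * B" for t x
        proof (cases "x \<in> cball 0 (R + 1)")
          case True
          have "\<bar>\<phi> (x - cis t *s e) * v x\<bar> \<le> D * B" unfolding abs_mult using D B(2)[OF True] by (intro mult_mono) auto
          thus ?thesis using D B by (auto simp: indicator_def)
        next
          case False thus ?thesis using supp D B by auto
        qed
      qed (use supp in auto)
      have e1: "(\<integral>\<theta>. indicator {0..2*pi} \<theta> * (\<phi> (x - cis \<theta> *s e) * v x) \<partial>lborel)
         = (LINT \<theta>:{0..2*pi}|lborel. \<phi> (x - cis \<theta> *s e)) * v x" for x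
        unfolding set_lebesgue_integral_def
        by (subst integral_mult_left_zero[symmetric]) (simp add: mult_ac)
      show ?int using lborel_pair.integrable_snd[OF intF] by (simp add: e1)
      have "2 * pi * (\<integral>x. \<phi> x * v x \<partial>lborel) \<le> (LINT \<theta>:{0..2*pi}|lborel. (\<integral>x. \<phi> x * v (x + cis \<theta> *s e) \<partial>lborel))"
        using weighted_circle_submean[of \<phi> D R "\<lambda>x. x" "\<lambda>x. e"] D 1(3) nonneg by auto
      also have "\<dots> = (LINT \<theta>:{0..2*pi}|lborel. (\<integral>x. \<phi> (x - cis \<theta> *s e) * v x \<partial>lborel))"
      proof -
        have "(\<integral>x. \<phi> x * v (x + cis \<theta> *s e) \<partial>lborel) = (\<integral>x. \<phi> (x - cis \<theta> *s e) * v x \<partial>lborel)" for \<theta>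
          using integral_lborel_shift[of "\<lambda>x. \<phi> (x - cis \<theta> *s e) * v x" "cis \<theta> *s e"] by simp
        thus ?thesis by simp
      qed
      also have "\<dots> = (\<integral>\<theta>. (\<integral>x. indicator {0..2*pi} \<theta> * (\<phi> (x - cis \<theta> *s e) * v x) \<partial>lborel) \<partial>lborel)"
        unfolding set_lebesgue_integral_def by simp
      also have "\<dots> = (\<integral>x. (\<integral>\<theta>. indicator {0..2*pi} \<theta> * (\<phi> (x - cis \<theta> *s e) * v x) \<partial>lborel) \<partial>lborel)"
        using lborel_pair.Fubini_integral[OF intF] by simp
      finally show ?le by (simp add: e1)
    qed
    have ax: "norm (axis j (of_real \<epsilon>) :: complex ^ 'n) \<le> 1" for j using \<epsilon> by (simp add: norm_axis_vec)
    have iM: "integrable lborel (\<lambda>x. ?M \<epsilon> x * v x)"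
      unfolding sum_distrib_right using int[OF ax] by (intro Bochner_Integration.integrable_sum) auto
    have "(\<Sum>j\<in>(UNIV::'n set). 2 * pi * (\<integral>x. \<phi> x * v x \<partial>lborel)) \<le> (\<Sum>j\<in>UNIV. \<integral>x. (LINT \<theta>:{0..2*pi}|lborel. \<phi> (x - cis \<theta> *s axis j (of_real \<epsilon>))) * v x \<partial>lborel)"
      using le[OF ax] by (intro sum_mono) auto
    also have "\<dots> = (\<integral>x. ?M \<epsilon> x * v x \<partial>lborel)"
      unfolding sum_distrib_right using int[OF ax] by (intro Bochner_Integration.integral_sum[symmetric]) auto
    also have "(\<Sum>j\<in>(UNIV::'n set). 2 * pi * (\<integral>x. \<phi> x * v x \<partial>lborel)) = 2 * pi * real CARD('n) * (\<integral>x. \<phi> x * v x \<partial>lborel)"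
    proof -
      have "(\<Sum>j\<in>(UNIV::'n set). 2 * pi * c) = 2 * pi * real CARD('n) * c" for c :: real by simp
      thus ?thesis .
    qed
    finally have A: "2 * pi * real CARD('n) * (\<integral>x. \<phi> x * v x \<partial>lborel) \<le> (\<integral>x. ?M \<epsilon> x * v x \<partial>lborel)" .
    have "(\<integral>x. ?M \<epsilon> x * v x \<partial>lborel) \<le> (\<integral>x. 2 * pi * real CARD('n) * (\<phi> x * v x) + 2 * pi * \<epsilon>\<^sup>2 * (\<Lambda> x * v x) + C * \<epsilon>^3 * (indicator (cball 0 S) x * \<bar>v x\<bar>) \<partial>lborel)"
    proof (rule integral_mono[OF iM])
      show "integrable lborel (\<lambda>x. 2 * pi * real CARD('n) * (\<phi> x * v x) + 2 * pi * \<epsilon>\<^sup>2 * (\<Lambda> x * v x) + C * \<epsilon>^3 * (indicator (cball 0 S) x * \<bar>v x\<bar>))"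
        by (intro Bochner_Integration.integrable_add integrable_mult_right i\<phi> i\<Lambda> iS)
      fix x
      define m where "m = ?M \<epsilon> x"
      let ?E = "m - 2 * pi * real CARD('n) * \<phi> x - 2 * pi * \<epsilon>\<^sup>2 * \<Lambda> x"
      have "?E * v x \<le> \<bar>?E\<bar> * \<bar>v x\<bar>" by (metis abs_ge_self abs_mult)
      also have "\<dots> \<le> C * \<epsilon> ^ 3 * indicator (cball 0 S) x * \<bar>v x\<bar>"
        using est[OF \<epsilon>, of x] unfolding m_def by (intro mult_right_mono) auto
      finally show "?M \<epsilon> x * v x \<le> 2 * pi * real CARD('n) * (\<phi> x * v x) + 2 * pi * \<epsilon>\<^sup>2 * (\<Lambda> x * v x) + C * \<epsilon>^3 * (indicator (cball 0 S) x * \<bar>v x\<bar>)"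
        unfolding m_def[symmetric] by (simp add: algebra_simps)
    qed
    also have "\<dots> = 2 * pi * real CARD('n) * (\<integral>x. \<phi> x * v x \<partial>lborel) + 2 * pi * \<epsilon>\<^sup>2 * I + C * \<epsilon>^3 * P"
      using i\<phi> i\<Lambda> iS by (simp add: P_def I_def)
    finally have "0 \<le> 2 * pi * \<epsilon>\<^sup>2 * I + C * \<epsilon>^3 * P" using A by linarith
    hence "0 \<le> \<epsilon>\<^sup>2 * (2 * pi * I + C * \<epsilon> * P)"
      by (simp add: algebra_simps power2_eq_square power3_eq_cube)
    thus ?thesis using \<epsilon> by (simp add: zero_le_mult_iff)
  qed
  have lim: "((\<lambda>\<epsilon>. - (C * \<epsilon> * P)) \<longlongrightarrow> - (C * 0 * P)) (at_right 0)"
    by (intro tendsto_intros)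
  have "- (C * 0 * P) \<le> 2 * pi * I"
  proof (rule tendsto_upperbound[OF lim])
    show "\<forall>\<^sub>F \<epsilon> in at_right 0. - (C * \<epsilon> * P) \<le> 2 * pi * I"
      unfolding eventually_at_right_field using key by (intro exI[of _ 1]) auto
  qed simp
  thus ?thesis using pi_gt_zero by (auto simp: zero_le_mult_iff I_def)
qed

end

section \<open>Bumps and their circle means\<close>

definition gap :: "real \<Rightarrow> complex ^ 'n \<Rightarrow> real" where
  "gap r x = max 0 (r\<^sup>2 - (norm x)\<^sup>2)"

definition bump :: "real \<Rightarrow> complex ^ 'n \<Rightarrow> real" where
  "bump r x = gap r x ^ 3"

text \<open>
  With \<open>y = r\<^sup>2 - |x|\<^sup>2\<close>, a shift of \<open>x\<close> along a circle of radius \<open>\<epsilon>\<close> in the \<open>j\<close>-th coordinate line changes \<open>y\<close> by an \<open>h\<close> with mean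
  \<open>-\<epsilon>\<^sup>2\<close> and mean square \<open>2 \<epsilon>\<^sup>2 |x\<^sub>j|\<^sup>2 + \<epsilon>\<^sup>4\<close>. Inserting this in the expansion of \<open>(y + h)\<^sup>3\<close> and summing
  over \<open>j\<close> gives the formula, which is a quarter of the Laplacian of the bump.
\<close>
definition bump_laplacian :: "real \<Rightarrow> complex ^ 'n \<Rightarrow> real" where
  "bump_laplacian r x = 6 * gap r x * (norm x)\<^sup>2 - 3 * real CARD('n) * (gap r x)\<^sup>2"

lemma gap_nonneg: "0 \<le> gap r x" by (simp add: gap_def)

lemma gap_eq_0: "0 \<le> r \<Longrightarrow> x \<notin> ball 0 r \<Longrightarrow> gap r x = 0"
  by (simp add: gap_def)

lemma gap_le: "gap r x \<le> r\<^sup>2" by (simp add: gap_def)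

lemma continuous_gap [continuous_intros]: "continuous_on S (\<lambda>x. gap r (f x))" if "continuous_on S f"
  unfolding gap_def using that by (intro continuous_intros)

text \<open>
  The cube is the least integer power of the positive part whose second derivative is Lipschitz,
  which gives a cubic remainder also across \<open>0\<close>.
\<close>
lemma cube_pos_taylor:
  fixes y h :: real
  shows "\<bar>max 0 (y + h) ^ 3 - (max 0 y ^ 3 + 3 * (max 0 y)\<^sup>2 * h + 3 * max 0 y * h\<^sup>2)\<bar> \<le> \<bar>h\<bar> ^ 3"
proof -
  have expand: "y ^ 3 + 3 * y\<^sup>2 * h + 3 * y * h\<^sup>2 = (y + h) ^ 3 - h ^ 3"
    by (simp add: power2_eq_square power3_eq_cube algebra_simps)
  consider "y \<ge> 0" "y + h \<ge> 0" | "y \<ge> 0" "y + h < 0" | "y < 0" "y + h \<ge> 0" | "y < 0" "y + h < 0" by linarith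
  thus ?thesis
  proof cases
    case 1 thus ?thesis using expand by (simp add: power_abs)
  next
    case 2
    define z where "z = - (y + h)"
    have z: "0 \<le> z" "z \<le> - h" "h = - (- h)" "\<bar>h\<bar> = - h" "y + h = - z" using 2 by (auto simp: z_def)
    hence "z ^ 3 \<le> - (h ^ 3)" "0 \<le> z ^ 3" "(y + h) ^ 3 = - (z ^ 3)"
      using power_mono[of z "- h" 3] by (auto simp: z(5))
    moreover have "\<bar>h\<bar> ^ 3 = - (h ^ 3)" using z(4) by simp
    moreover have "max 0 y = y" "max 0 (y + h) = 0" using 2 by auto
    ultimately show ?thesis using expand by simp
  next
    case 3
    hence "(y + h) ^ 3 \<le> h ^ 3" "0 \<le> (y+h)^3" "\<bar>h\<bar> = h" by (auto intro: power_mono)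
    thus ?thesis using 3 by simp
  next
    case 4 thus ?thesis by simp
  qed
qed

lemma norm_diff_cis_axis:
  fixes x :: "complex ^ 'n"
  shows "(norm (x - cis \<theta> *s axis j (of_real \<epsilon>)))\<^sup>2 = (norm x)\<^sup>2 - 2 * \<epsilon> * Re (cnj (x $ j) * cis \<theta>) + \<epsilon>\<^sup>2"
proof -
  let ?e = "cis \<theta> *s axis j (of_real \<epsilon>) :: complex ^ 'n"
  have e: "?e = axis j (cis \<theta> * of_real \<epsilon>)" by (auto simp: vec_eq_iff axis_def)
  have "x \<bullet> ?e = x $ j \<bullet> (cis \<theta> * of_real \<epsilon>)" unfolding e by (simp add: inner_axis)
  also have "\<dots> = \<epsilon> * Re (cnj (x $ j) * cis \<theta>)" by (simp add: inner_complex_def algebra_simps)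
  finally have i: "x \<bullet> ?e = \<epsilon> * Re (cnj (x $ j) * cis \<theta>)" .
  have n: "norm ?e = \<bar>\<epsilon>\<bar>" by (simp add: norm_scalar_mult norm_axis_vec)
  have "(norm (x - ?e))\<^sup>2 = (norm x)\<^sup>2 + (norm ?e)\<^sup>2 - 2 * (x \<bullet> ?e)"
    by (simp add: power2_norm_eq_inner algebra_simps inner_commute)
  thus ?thesis by (simp add: i n)
qed

lemma sum_norm_components: "(\<Sum>j\<in>UNIV. (cmod (x $ j))\<^sup>2) = (norm (x :: complex ^ 'n))\<^sup>2"
  by (simp add: norm_vec_def L2_set_def sum_nonneg)

lemma circle_mean_bump:
  fixes x :: "complex ^ 'n"
  assumes \<epsilon>: "0 < \<epsilon>" "\<epsilon> \<le> 1" and r: "0 < r"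
  shows "\<bar>(LINT \<theta>:{0..2*pi}|lborel. bump r (x - cis \<theta> *s axis j (of_real \<epsilon>)))
     - 2 * pi * (bump r x + \<epsilon>\<^sup>2 * (6 * gap r x * (cmod (x $ j))\<^sup>2 - 3 * (gap r x)\<^sup>2) + 3 * gap r x * \<epsilon>^4)\<bar>
     \<le> 2 * pi * (2 * norm x + 1) ^ 3 * \<epsilon> ^ 3"
proof -
  let ?g = "gap r x" and ?w = "cnj (x $ j)"
  define h where "h \<theta> = 2 * \<epsilon> * Re (?w * cis \<theta>) - \<epsilon>\<^sup>2" for \<theta>
  define Q where "Q \<theta> = ?g ^ 3 + 3 * ?g\<^sup>2 * h \<theta> + 3 * ?g * (h \<theta>)\<^sup>2" for \<theta>
  have hle: "\<bar>h \<theta>\<bar> \<le> (2 * norm x + 1) * \<epsilon>" for \<theta>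
  proof -
    have "\<bar>Re (?w * cis \<theta>)\<bar> \<le> cmod (?w * cis \<theta>)" by (rule abs_Re_le_cmod)
    also have "\<dots> \<le> norm x" using Finite_Cartesian_Product.norm_nth_le[of x j] by (simp add: norm_mult)
    finally have "\<bar>2 * \<epsilon> * Re (?w * cis \<theta>)\<bar> \<le> 2 * \<epsilon> * norm x" using \<epsilon> by (simp add: abs_mult)
    moreover have "\<epsilon>\<^sup>2 \<le> \<epsilon>" using \<epsilon> by (simp add: power2_eq_square mult_le_cancel_left1)
    moreover have "0 \<le> \<epsilon>\<^sup>2" by simp
    moreover have "(2 * norm x + 1) * \<epsilon> = 2 * \<epsilon> * norm x + \<epsilon>" by (simp add: algebra_simps)
    ultimately show ?thesis unfolding h_def by linarith
  qed
  have b: "bump r (x - cis \<theta> *s axis j (of_real \<epsilon>)) = max 0 ((r\<^sup>2 - (norm x)\<^sup>2) + h \<theta>) ^ 3" for \<theta>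
    unfolding bump_def gap_def norm_diff_cis_axis h_def by (simp add: algebra_simps)
  have pt: "\<bar>bump r (x - cis \<theta> *s axis j (of_real \<epsilon>)) - Q \<theta>\<bar> \<le> (2 * norm x + 1) ^ 3 * \<epsilon> ^ 3" for \<theta>
  proof -
    have "\<bar>bump r (x - cis \<theta> *s axis j (of_real \<epsilon>)) - Q \<theta>\<bar> \<le> \<bar>h \<theta>\<bar> ^ 3"
      unfolding b Q_def gap_def by (rule cube_pos_taylor)
    also have "\<dots> \<le> ((2 * norm x + 1) * \<epsilon>) ^ 3" using hle by (intro power_mono) auto
    finally show ?thesis by (simp add: power_mult_distrib)
  qed
  have cb: "continuous_on UNIV (\<lambda>\<theta>. bump r (x - cis \<theta> *s axis j (of_real \<epsilon>)))"
    unfolding bump_def by (intro continuous_intros)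
  have cR: "continuous_on UNIV (\<lambda>\<theta>. Re (?w * cis \<theta>))" by (intro continuous_intros)
  have cQ: "continuous_on UNIV Q" unfolding Q_def h_def by (intro continuous_intros)
  note iR = set_integrable_circle[OF cR]
  have iR2: "set_integrable lborel {0..2*pi} (\<lambda>\<theta>. (Re (?w * cis \<theta>))\<^sup>2)"
    by (intro set_integrable_circle continuous_intros)
  have ic: "set_integrable lborel {0..2*pi} (\<lambda>\<theta>. c)" for c :: real
    by (intro set_integrable_circle continuous_intros)
  define q0 q1 q2 where "q0 = ?g ^ 3 - 3 * ?g\<^sup>2 * \<epsilon>\<^sup>2 + 3 * ?g * \<epsilon> ^ 4"
    and "q1 = 6 * ?g\<^sup>2 * \<epsilon> - 12 * ?g * \<epsilon> ^ 3" and "q2 = 12 * ?g * \<epsilon>\<^sup>2"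
  have "Q = (\<lambda>\<theta>. q0 + q1 * Re (?w * cis \<theta>) + q2 * (Re (?w * cis \<theta>))\<^sup>2)"
    unfolding Q_def h_def q0_def q1_def q2_def by (intro ext) algebra
  hence "(LINT \<theta>:{0..2*pi}|lborel. Q \<theta>) = (LINT \<theta>:{0..2*pi}|lborel. q0 + q1 * Re (?w * cis \<theta>) + q2 * (Re (?w * cis \<theta>))\<^sup>2)" by simp
  also have "\<dots> = (LINT \<theta>:{0..2*pi}|lborel. q0) + (LINT \<theta>:{0..2*pi}|lborel. q1 * Re (?w * cis \<theta>)) + (LINT \<theta>:{0..2*pi}|lborel. q2 * (Re (?w * cis \<theta>))\<^sup>2)"
    using ic iR iR2 by (simp only: set_integral_add set_integrable_mult_right simp_thms)
  also have "\<dots> = 2 * pi * q0 + q2 * (pi * (cmod (x $ j))\<^sup>2)"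
    by (simp only: set_integral_mult_right circle_integral_const circle_integral_Re circle_integral_Re_squared complex_mod_cnj mult_zero_right add_0_right)
  also have "\<dots> = 2 * pi * (bump r x + \<epsilon>\<^sup>2 * (6 * ?g * (cmod (x $ j))\<^sup>2 - 3 * ?g\<^sup>2) + 3 * ?g * \<epsilon>^4)"
    by (simp add: q0_def q2_def bump_def algebra_simps)
  finally have IQ: "(LINT \<theta>:{0..2*pi}|lborel. Q \<theta>) = \<dots>" .
  have "\<bar>(LINT \<theta>:{0..2*pi}|lborel. bump r (x - cis \<theta> *s axis j (of_real \<epsilon>))) - (LINT \<theta>:{0..2*pi}|lborel. Q \<theta>)\<bar>
      = \<bar>LINT \<theta>:{0..2*pi}|lborel. bump r (x - cis \<theta> *s axis j (of_real \<epsilon>)) - Q \<theta>\<bar>"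
    using set_integrable_circle[OF cb] set_integrable_circle[OF cQ] by (simp add: set_integral_diff)
  also have "\<dots> \<le> (LINT \<theta>:{0..2*pi}|lborel. \<bar>bump r (x - cis \<theta> *s axis j (of_real \<epsilon>)) - Q \<theta>\<bar>)"
    using set_integral_norm_bound[of lborel "{0..2*pi}" "\<lambda>\<theta>. bump r (x - cis \<theta> *s axis j (of_real \<epsilon>)) - Q \<theta>"]
      set_integrable_circle[OF cb] set_integrable_circle[OF cQ] by (simp add: set_integral_diff)
  also have "\<dots> \<le> (LINT \<theta>:{0..2*pi}|lborel. (2 * norm x + 1) ^ 3 * \<epsilon> ^ 3)"
    using pt cb cQ by (intro set_integral_mono set_integrable_circle continuous_intros) auto
  finally show ?thesis unfolding IQ circle_integral_const by (simp add: mult_ac)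
qed

lemma circle_taylor_bump:
  fixes a :: "complex ^ 'n"
  assumes r: "0 < r"
  shows "circle_taylor (\<lambda>x. bump r (x - a)) (\<lambda>x. bump_laplacian r (x - a))"
  unfolding circle_taylor_def
proof (intro conjI)
  let ?M = "\<lambda>\<epsilon> x. \<Sum>j\<in>(UNIV::'n set). LINT \<theta>:{0..2*pi}|lborel. bump r (x - cis \<theta> *s axis j (of_real \<epsilon>) - a)"
  have out: "bump r (x - a) = 0 \<and> bump_laplacian r (x - a) = 0" if "x \<notin> cball 0 (norm a + r)" for x
  proof -
    have "norm x \<le> norm (x - a) + norm a" by norm
    hence "x - a \<notin> ball 0 r" using that by auto
    from gap_eq_0[OF _ this] r show ?thesis by (simp add: bump_def bump_laplacian_def)
  qed
  show "continuous_on UNIV (\<lambda>x. bump r (x - a))" "continuous_on UNIV (\<lambda>x. bump_laplacian r (x - a))"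
    unfolding bump_def bump_laplacian_def by (intro continuous_intros)+
  show "\<exists>R. \<forall>x. x \<notin> cball 0 R \<longrightarrow> bump r (x - a) = 0 \<and> bump_laplacian r (x - a) = 0"
    using out by blast
  let ?n = "real CARD('n)"
  let ?C = "2 * pi * ?n * (2 * (r + 1) + 1) ^ 3 + 6 * pi * ?n * r\<^sup>2" and ?R = "norm a + r + 1"
  show "\<exists>C R. \<forall>\<epsilon> x. 0 < \<epsilon> \<and> \<epsilon> \<le> 1 \<longrightarrow> \<bar>?M \<epsilon> x - 2 * pi * ?n * bump r (x - a) - 2 * pi * \<epsilon>\<^sup>2 * bump_laplacian r (x - a)\<bar>
        \<le> C * \<epsilon> ^ 3 * indicator (cball 0 R) x"
  proof (rule exI[of _ ?C], rule exI[of _ ?R], intro allI impI)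
    fix \<epsilon> :: real and x :: "complex ^ 'n" assume \<epsilon>: "0 < \<epsilon> \<and> \<epsilon> \<le> 1"
    show "\<bar>?M \<epsilon> x - 2 * pi * ?n * bump r (x - a) - 2 * pi * \<epsilon>\<^sup>2 * bump_laplacian r (x - a)\<bar>
        \<le> ?C * \<epsilon> ^ 3 * indicator (cball 0 ?R) x"
    proof (cases "norm (x - a) \<le> r + 1")
      case False
      have z: "bump r (x - cis \<theta> *s axis j (of_real \<epsilon>) - a) = 0" for \<theta> j
      proof -
        have "norm (cis \<theta> *s axis j (of_real \<epsilon>) :: complex ^ 'n) \<le> 1" using \<epsilon> by (simp add: norm_scalar_mult norm_axis_vec)
        moreover have "norm (x - a) \<le> norm (x - cis \<theta> *s axis j (of_real \<epsilon>) - a) + norm (cis \<theta> *s axis j (of_real \<epsilon>) :: complex ^ 'n)"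
          by norm
        ultimately have "x - cis \<theta> *s axis j (of_real \<epsilon>) - a \<notin> ball 0 r" using False by auto
        from gap_eq_0[OF _ this] r show ?thesis by (simp add: bump_def)
      qed
      have z0: "gap r (x - a) = 0" using False r by (intro gap_eq_0) auto
      have "bump r (x - a) = 0" "bump_laplacian r (x - a) = 0" by (simp_all add: bump_def bump_laplacian_def z0)
      thus ?thesis using \<epsilon> r by (simp add: z circle_integral_const)
    next
      case True
      have "norm x \<le> norm (x - a) + norm a" by norm
      hence inb: "x \<in> cball 0 ?R" using True by auto
      let ?y = "x - a" and ?g = "gap r (x - a)"
      let ?q = "\<lambda>j. 2 * pi * (bump r ?y + \<epsilon>\<^sup>2 * (6 * ?g * (cmod (?y $ j))\<^sup>2 - 3 * ?g\<^sup>2) + 3 * ?g * \<epsilon>^4)"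
      have "(\<Sum>j\<in>UNIV. ?q j) = 2 * pi * (\<Sum>j\<in>UNIV. (bump r ?y + \<epsilon>\<^sup>2 * (6 * ?g * (cmod (?y $ j))\<^sup>2 - 3 * ?g\<^sup>2) + 3 * ?g * \<epsilon>^4))"
        by (simp add: sum_distrib_left)
      also have "(\<Sum>j\<in>UNIV. (bump r ?y + \<epsilon>\<^sup>2 * (6 * ?g * (cmod (?y $ j))\<^sup>2 - 3 * ?g\<^sup>2) + 3 * ?g * \<epsilon>^4))
         = ?n * bump r ?y + \<epsilon>\<^sup>2 * (6 * ?g * (norm ?y)\<^sup>2 - ?n * (3 * ?g\<^sup>2)) + ?n * (3 * ?g * \<epsilon>^4)"
      proof -
        have "(\<Sum>j\<in>UNIV. \<epsilon>\<^sup>2 * (6 * ?g * (cmod (?y $ j))\<^sup>2 - 3 * ?g\<^sup>2)) = \<epsilon>\<^sup>2 * (\<Sum>j\<in>UNIV. 6 * ?g * (cmod (?y $ j))\<^sup>2 - 3 * ?g\<^sup>2)"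
          by (rule sum_distrib_left[symmetric])
        also have "(\<Sum>j\<in>UNIV. 6 * ?g * (cmod (?y $ j))\<^sup>2 - 3 * ?g\<^sup>2) = (\<Sum>j\<in>UNIV. 6 * ?g * (cmod (?y $ j))\<^sup>2) - ?n * (3 * ?g\<^sup>2)"
          by (simp add: sum_subtractf)
        also have "(\<Sum>j\<in>UNIV. 6 * ?g * (cmod (?y $ j))\<^sup>2) = 6 * ?g * (norm ?y)\<^sup>2"
          unfolding sum_norm_components[symmetric] by (rule sum_distrib_left[symmetric])
        finally show ?thesis by (simp add: sum.distrib)
      qed
      also have "2 * pi * \<dots> = 2 * pi * ?n * bump r ?y + 2 * pi * \<epsilon>\<^sup>2 * bump_laplacian r ?y + 6 * pi * ?n * ?g * \<epsilon>^4"
      proof -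
        have "2 * pi * (n * b + e * (6 * g * s - n * (3 * g\<^sup>2)) + n * (3 * g * e4))
           = 2 * pi * n * b + 2 * pi * e * (6 * g * s - 3 * n * g\<^sup>2) + 6 * pi * n * g * e4" for n b e g s e4 :: real
          by (simp add: algebra_simps)
        thus ?thesis unfolding bump_laplacian_def .
      qed
      finally have sq: "(\<Sum>j\<in>UNIV. ?q j) = 2 * pi * ?n * bump r ?y + 2 * pi * \<epsilon>\<^sup>2 * bump_laplacian r ?y + 6 * pi * ?n * ?g * \<epsilon>^4" .
      let ?m = "\<lambda>j. LINT \<theta>:{0..2*pi}|lborel. bump r (?y - cis \<theta> *s axis j (of_real \<epsilon>))"
      have shift: "x - cis \<theta> *s axis j (of_real \<epsilon>) - a = ?y - cis \<theta> *s axis j (of_real \<epsilon>)" for \<theta> j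
        by (simp add: algebra_simps)
      have M: "?M \<epsilon> x = (\<Sum>j\<in>UNIV. ?m j)" unfolding shift ..
      have "\<bar>?m j - ?q j\<bar> \<le> 2 * pi * (2 * norm ?y + 1) ^ 3 * \<epsilon> ^ 3" for j
        by (rule circle_mean_bump) (use \<epsilon> r in auto)
      hence "(\<Sum>j\<in>UNIV. \<bar>?m j - ?q j\<bar>) \<le> (\<Sum>j\<in>(UNIV::'n set). 2 * pi * (2 * norm ?y + 1) ^ 3 * \<epsilon> ^ 3)"
        by (rule sum_mono)
      hence "\<bar>?M \<epsilon> x - (\<Sum>j\<in>UNIV. ?q j)\<bar> \<le> (\<Sum>j\<in>(UNIV::'n set). 2 * pi * (2 * norm ?y + 1) ^ 3 * \<epsilon> ^ 3)"
        unfolding M sum_subtractf[symmetric] by (rule order_trans[OF sum_abs])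
      also have "\<dots> = 2 * pi * ?n * (2 * norm ?y + 1) ^ 3 * \<epsilon> ^ 3" by simp
      also have "\<dots> \<le> 2 * pi * ?n * (2 * (r + 1) + 1) ^ 3 * \<epsilon> ^ 3"
        using True \<epsilon> by (intro mult_right_mono mult_left_mono power_mono) auto
      finally have A: "\<bar>?M \<epsilon> x - (\<Sum>j\<in>UNIV. ?q j)\<bar> \<le> \<dots>" .
      have "\<epsilon> ^ 4 \<le> \<epsilon> ^ 3" using \<epsilon> by (intro power_decreasing) auto
      hence "?g * \<epsilon>^4 \<le> r\<^sup>2 * \<epsilon>^3" using gap_le gap_nonneg \<epsilon> by (intro mult_mono) auto
      hence "6 * pi * ?n * (?g * \<epsilon>^4) \<le> 6 * pi * ?n * (r\<^sup>2 * \<epsilon>^3)" by (intro mult_left_mono) auto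
      moreover have "0 \<le> 6 * pi * ?n * (?g * \<epsilon>^4)" using gap_nonneg[of r ?y] \<epsilon> by auto
      ultimately have "\<bar>6 * pi * ?n * ?g * \<epsilon>^4\<bar> \<le> 6 * pi * ?n * r\<^sup>2 * \<epsilon>^3" by (simp add: mult.assoc)
      moreover have tri: "\<bar>m - p - q\<bar> \<le> c1 + c2" if "\<bar>m - s\<bar> \<le> c1" "s = p + q + t" "\<bar>t\<bar> \<le> c2" for m s p q t c1 c2 :: real
        using that by linarith
      ultimately have "\<bar>?M \<epsilon> x - 2 * pi * ?n * bump r ?y - 2 * pi * \<epsilon>\<^sup>2 * bump_laplacian r ?y\<bar>
          \<le> 2 * pi * ?n * (2 * (r + 1) + 1) ^ 3 * \<epsilon> ^ 3 + 6 * pi * ?n * r\<^sup>2 * \<epsilon>^3"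
        using A sq by blast
      also have "\<dots> = ?C * \<epsilon> ^ 3 * indicator (cball 0 ?R) x"
        using inb by (simp add: distrib_right)
      finally show ?thesis .
    qed
  qed
qed

section \<open>Growth of the kernel means\<close>

lemma bump_laplacian_eq_0: "0 \<le> r \<Longrightarrow> x \<notin> ball 0 r \<Longrightarrow> bump_laplacian r x = 0"
  by (simp add: bump_laplacian_def gap_eq_0)

lemma bump_laplacian_bound:
  fixes x :: "complex ^ 'n"
  assumes "0 \<le> r"
  shows "\<bar>bump_laplacian r x\<bar> \<le> (6 + 3 * real CARD('n)) * r ^ 4"
proof (cases "x \<in> ball 0 r")
  case True
  have g: "0 \<le> gap r x" "gap r x \<le> r\<^sup>2" by (auto simp: gap_nonneg gap_le)
  have n: "(norm x)\<^sup>2 \<le> r\<^sup>2" using True by (intro power_mono) auto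
  have r4: "r ^ 4 = r\<^sup>2 * r\<^sup>2" by (simp add: power2_eq_square power4_eq_xxxx)
  have "gap r x * (norm x)\<^sup>2 \<le> r ^ 4" unfolding r4 using g n by (intro mult_mono) auto
  moreover have "gap r x * gap r x \<le> r ^ 4" unfolding r4 using g by (intro mult_mono) auto
  hence "real CARD('n) * (gap r x)\<^sup>2 \<le> real CARD('n) * r ^ 4" by (simp add: power2_eq_square)
  moreover have "0 \<le> gap r x * (norm x)\<^sup>2" "0 \<le> real CARD('n) * (gap r x)\<^sup>2" using g by auto
  moreover have "0 \<le> real CARD('n) * r ^ 4" by simp
  ultimately have "\<bar>6 * (gap r x * (norm x)\<^sup>2) - 3 * (real CARD('n) * (gap r x)\<^sup>2)\<bar> \<le> 6 * r ^ 4 + 3 * (real CARD('n) * r ^ 4)"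
    by linarith
  thus ?thesis unfolding bump_laplacian_def by (simp add: mult.assoc distrib_right)
next
  case False thus ?thesis using assms by (simp add: bump_laplacian_eq_0)
qed

text \<open>
  Up to normalisation, the kernel is a probability density at scale \<open>r\<close>; the exponent \<open>2n + 4\<close>
  makes its integral independent of \<open>r\<close>. The square of the gap is chosen so that the derivative in \<open>r\<close>
  is a multiple of \<open>bump_laplacian\<close>.
\<close>
definition mean_kernel :: "real \<Rightarrow> complex ^ 'n \<Rightarrow> real" where
  "mean_kernel r x = (gap r x)\<^sup>2 / r ^ (2 * CARD('n) + 4)"

lemma kernel_nonneg: "0 \<le> r \<Longrightarrow> 0 \<le> mean_kernel r x"
  by (simp add: mean_kernel_def)

lemma kernel_eq_0: "0 \<le> r \<Longrightarrow> x \<notin> ball 0 r \<Longrightarrow> mean_kernel r x = 0"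
  by (simp add: mean_kernel_def gap_eq_0)

lemma kernel_le:
  fixes x :: "complex ^ 'n"
  assumes "0 < r" shows "mean_kernel r x \<le> 1 / r ^ (2 * CARD('n))"
proof -
  have "(gap r x)\<^sup>2 \<le> (r\<^sup>2)\<^sup>2" using gap_nonneg gap_le by (intro power_mono) auto
  hence "mean_kernel r x \<le> (r\<^sup>2)\<^sup>2 / r ^ (2 * CARD('n) + 4)"
    unfolding mean_kernel_def using assms by (intro divide_right_mono) auto
  also have "\<dots> = 1 / r ^ (2 * CARD('n))" using assms by (simp add: power_add flip: power_mult)
  finally show ?thesis .
qed

lemma continuous_kernel: "continuous_on S (\<lambda>x. mean_kernel r (f x))" if "continuous_on S f"
  unfolding mean_kernel_def divide_inverse using that by (intro continuous_intros)

lemma measurable_kernel [measurable]: "(\<lambda>x. mean_kernel r (x - a)) \<in> borel_measurable borel"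
  by (intro borel_measurable_continuous_onI continuous_kernel continuous_intros)

lemma measurable_bump_laplacian [measurable]: "(\<lambda>x. bump_laplacian r (x - a)) \<in> borel_measurable borel"
  unfolding bump_laplacian_def by (intro borel_measurable_continuous_onI continuous_intros)

lemma integrable_kernel: "0 < r \<Longrightarrow> integrable lborel (\<lambda>x :: complex ^ 'n. mean_kernel r (x - a))"
  by (rule integrable_bounded_support[where a=a and R=r and B="1 / r ^ (2 * CARD('n))"])
     (auto simp: kernel_le kernel_nonneg dist_norm norm_minus_commute intro: kernel_eq_0)

lemma DERIV_max_0_squared: "((\<lambda>y. (max 0 y)\<^sup>2) has_real_derivative 2 * max 0 y) (at y)"
proof -
  consider "y > 0" | "y < 0" | "y = 0" by linarith
  thus ?thesis
  proof cases
    case 1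
    have "((\<lambda>y. y\<^sup>2) has_real_derivative 2 * max 0 y) (at y)"
      using 1 by (auto intro!: derivative_eq_intros)
    thus ?thesis by (rule has_field_derivative_transform_within_open[where S="{0<..}"]) (use 1 in auto)
  next
    case 2
    have "((\<lambda>y. 0) has_real_derivative 2 * max 0 y) (at y)"
      using 2 by (auto intro!: derivative_eq_intros)
    thus ?thesis by (rule has_field_derivative_transform_within_open[where S="{..<0}"]) (use 2 in auto)
  next
    case 3
    have "((\<lambda>h::real. (max 0 h)\<^sup>2 / h) \<longlongrightarrow> 0) (at 0)"
    proof (rule Lim_null_comparison)
      show "\<forall>\<^sub>F h in at 0. norm ((max 0 h)\<^sup>2 / h) \<le> \<bar>h\<bar>"
        by (intro always_eventually) (auto simp: max_def power2_eq_square)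
      show "((\<lambda>h::real. \<bar>h\<bar>) \<longlongrightarrow> 0) (at 0)" by (rule tendsto_rabs_zero) (rule tendsto_ident_at)
    qed
    thus ?thesis using 3 by (simp add: has_field_derivative_iff)
  qed
qed

text \<open>
  In the derivative \<open>4 r\<^sup>2 g - (2 n + 4) g\<^sup>2\<close> (times a power of \<open>r\<close>), with \<open>g\<close> the gap, the identity
  \<open>g r\<^sup>2 = g\<^sup>2 + g |x|\<^sup>2\<close> leaves \<open>4 g |x|\<^sup>2 - 2 n g\<^sup>2\<close>.
\<close>
lemma DERIV_kernel:
  fixes x :: "complex ^ 'n"
  assumes r: "0 < r"
  shows "((\<lambda>r. mean_kernel r x) has_real_derivative 2 / 3 / r ^ (2 * CARD('n) + 5) * bump_laplacian r x) (at r)"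
proof -
  let ?m = "2 * CARD('n) + 4"
  have m: "real ?m = 2 * real CARD('n) + 4" by simp
  have g: "((\<lambda>r. (gap r x)\<^sup>2) has_real_derivative 2 * gap r x * (2 * r)) (at r)"
    unfolding gap_def by (rule DERIV_chain2[OF DERIV_max_0_squared]) (auto intro!: derivative_eq_intros)
  have p: "((\<lambda>r. r ^ ?m) has_real_derivative real ?m * r ^ (?m - 1)) (at r)"
    unfolding One_nat_def by (rule DERIV_pow)
  have "((\<lambda>r. (gap r x)\<^sup>2 / r ^ ?m) has_real_derivative
     (2 * gap r x * (2 * r) * r ^ ?m - (gap r x)\<^sup>2 * (real ?m * r ^ (?m - 1))) / (r ^ ?m * r ^ ?m)) (at r)"
    by (rule DERIV_divide[OF g p]) (use r in auto)
  also have "(2 * gap r x * (2 * r) * r ^ ?m - (gap r x)\<^sup>2 * (real ?m * r ^ (?m - 1))) / (r ^ ?m * r ^ ?m)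
      = (4 * (gap r x * r\<^sup>2) - real ?m * (gap r x)\<^sup>2) / r ^ (?m + 1)"
  proof -
    define q where "q = r ^ (?m - 1)"
    have m1: "r ^ ?m = r * q" unfolding q_def by (subst power_eq_if) simp
    moreover have "r ^ (?m + 1) = r\<^sup>2 * q" unfolding power_add[of r ?m 1] m1 by (simp add: power2_eq_square)
    moreover have "q \<noteq> 0" using r by (simp add: q_def)
    ultimately show ?thesis unfolding q_def[symmetric] using r by (simp add: field_simps power2_eq_square)
  qed
  also have "gap r x * r\<^sup>2 = (gap r x)\<^sup>2 + gap r x * (norm x)\<^sup>2"
    by (auto simp: gap_def max_def power2_eq_square algebra_simps)
  also have "(4 * ((gap r x)\<^sup>2 + gap r x * (norm x)\<^sup>2) - real ?m * (gap r x)\<^sup>2) / r ^ (?m + 1)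
     = 2 / 3 / r ^ (2 * CARD('n) + 5) * bump_laplacian r x"
  proof -
    have "(4 * (g\<^sup>2 + g * s) - (2 * N + 4) * g\<^sup>2) / q = 2 / 3 / q * (6 * g * s - 3 * N * g\<^sup>2)" if "q \<noteq> 0" for g s N q :: real
      using that by (simp add: field_simps)
    moreover have "?m + 1 = 2 * CARD('n) + 5" by simp
    ultimately show ?thesis unfolding m bump_laplacian_def using r by (simp only: power_not_zero less_imp_neq[symmetric] not_False_eq_True)
  qed
  finally show ?thesis unfolding mean_kernel_def .
qed

lemma kernel_diff_eq_integral:
  fixes x :: "complex ^ 'n"
  assumes "0 < e" "e \<le> d"
  shows "(LINT r:{e..d}|lborel. 2 / 3 / r ^ (2 * CARD('n) + 5) * bump_laplacian r x) = mean_kernel d x - mean_kernel e x"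
proof (rule set_integral_FTC)
  show "((\<lambda>r. mean_kernel r x) has_real_derivative 2 / 3 / r ^ (2 * CARD('n) + 5) * bump_laplacian r x) (at r)"
    if "e \<le> r" "r \<le> d" for r using that assms by (intro DERIV_kernel) auto
  show "continuous_on {e..d} (\<lambda>r. 2 / 3 / r ^ (2 * CARD('n) + 5) * bump_laplacian r x)"
    unfolding bump_laplacian_def gap_def using assms by (intro continuous_intros) auto
qed (use assms in auto)

context bounded_psh
begin

definition kernel_mean :: "complex ^ 'n \<Rightarrow> real \<Rightarrow> real" where
  "kernel_mean a r = (\<integral>x. mean_kernel r (x - a) * v x \<partial>lborel)"

text \<open>
  A multiple of the integral of \<open>bump r (x - a)\<close> against the Riesz measure of \<open>v\<close>, hence at most
  of the order of \<open>r ^ 6\<close> times the Riesz mass of the ball of radius \<open>r\<close> around \<open>a\<close>.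
\<close>
definition riesz_mass :: "complex ^ 'n \<Rightarrow> real \<Rightarrow> real" where
  "riesz_mass a r = (\<integral>x. bump_laplacian r (x - a) * v x \<partial>lborel)"

lemma integrable_kernel_mult: "0 < r \<Longrightarrow> integrable lborel (\<lambda>x. mean_kernel r (x - a) * v x)"
  by (rule integrable_weighted[where a=a and R=r and B="1 / r ^ (2 * CARD('n))"])
     (auto simp: kernel_le kernel_nonneg dist_norm norm_minus_commute intro: kernel_eq_0)

lemma integrable_bump_laplacian_mult: "0 < r \<Longrightarrow> integrable lborel (\<lambda>x. bump_laplacian r (x - a) * v x)"
  by (rule integrable_weighted[where a=a and R=r and B="(6 + 3 * real CARD('n)) * r ^ 4"])
     (auto simp: dist_norm norm_minus_commute intro!: bump_laplacian_eq_0 bump_laplacian_bound)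

lemma riesz_mass_sum_nonneg:
  assumes I: "finite I" "\<And>i. i \<in> I \<Longrightarrow> 0 < r i" and nonneg: "\<And>x. 0 \<le> (\<Sum>i\<in>I. c i * bump (r i) (x - a i))"
  shows "0 \<le> (\<Sum>i\<in>I. c i * riesz_mass (a i) (r i))"
proof -
  have "0 \<le> (\<integral>x. (\<Sum>i\<in>I. c i * bump_laplacian (r i) (x - a i)) * v x \<partial>lborel)"
    by (rule circle_laplacian_nonneg[OF circle_taylor_sum]) (use I nonneg in \<open>auto intro: circle_taylor_bump\<close>)
  also have "\<dots> = (\<integral>x. (\<Sum>i\<in>I. c i * (bump_laplacian (r i) (x - a i) * v x)) \<partial>lborel)"
    by (simp add: sum_distrib_right mult.assoc)
  also have "\<dots> = (\<Sum>i\<in>I. c i * riesz_mass (a i) (r i))"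
    unfolding riesz_mass_def using I integrable_bump_laplacian_mult
    by (subst Bochner_Integration.integral_sum) auto
  finally show ?thesis .
qed

text \<open>
  Fubini, applied to the pointwise identity \<open>kernel_diff_eq_integral\<close>.
\<close>
lemma kernel_mean_diff:
  assumes "0 < e" "e \<le> d"
  shows "kernel_mean a d - kernel_mean a e = (LINT r:{e..d}|lborel. 2 / 3 / r ^ (2 * CARD('n) + 5) * riesz_mass a r)"
    and "set_integrable lborel {e..d} (\<lambda>r. 2 / 3 / r ^ (2 * CARD('n) + 5) * riesz_mass a r)"
proof -
  let ?c = "\<lambda>r. 2 / 3 / r ^ (2 * CARD('n) + 5)"
  let ?F = "\<lambda>(r, x). indicator {e..d} r * (?c r * bump_laplacian r (x - a) * v x)"
  obtain B where B: "B \<ge> 0" "\<And>x. x \<in> cball a d \<Longrightarrow> \<bar>v x\<bar> \<le> B" using bounded_on_cball by blast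
  have supp: "bump_laplacian r (x - a) = 0" if "r \<in> {e..d}" "x \<notin> cball a d" for r x
    using that assms by (intro bump_laplacian_eq_0) (auto simp: dist_norm norm_minus_commute)
  have "(\<lambda>p. bump_laplacian (fst p) (snd p - a)) \<in> borel_measurable (borel :: (real \<times> (complex ^ 'n)) measure)"
    unfolding bump_laplacian_def gap_def by (intro borel_measurable_continuous_onI continuous_intros)
  hence "?F \<in> borel_measurable borel"
    unfolding case_prod_beta unfolding borel_prod[symmetric] by measurable
  hence int: "integrable (lborel \<Otimes>\<^sub>M lborel) ?F"
  proof (rule integrable_bounded_support_pair[where c=e and d=d and a=a and R=d
      and B="2 / 3 / e ^ (2 * CARD('n) + 5) * ((6 + 3 * real CARD('n)) * d ^ 4) * B"])
    show "\<bar>?F (r, x)\<bar> \<le> 2 / 3 / e ^ (2 * CARD('n) + 5) * ((6 + 3 * real CARD('n)) * d ^ 4) * B" (is "_ \<le> ?B") for r x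
    proof (cases "r \<in> {e..d} \<and> x \<in> cball a d")
      case True
      have "0 \<le> ?c r" "?c r \<le> 2 / 3 / e ^ (2 * CARD('n) + 5)"
        using True assms by (auto intro!: divide_left_mono power_mono mult_pos_pos)
      moreover have "\<bar>bump_laplacian r (x - a)\<bar> \<le> (6 + 3 * real CARD('n)) * d ^ 4"
      proof -
        have "\<bar>bump_laplacian r (x - a)\<bar> \<le> (6 + 3 * real CARD('n)) * r ^ 4"
          using True assms by (intro bump_laplacian_bound) auto
        also have "\<dots> \<le> (6 + 3 * real CARD('n)) * d ^ 4"
          using True assms by (intro mult_left_mono power_mono) auto
        finally show ?thesis .
      qed
      ultimately have "\<bar>?c r * bump_laplacian r (x - a) * v x\<bar> \<le> ?B"
        unfolding abs_mult using B True assms by (intro mult_mono) auto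
      thus ?thesis using True by simp
    next
      case False
      hence "?F (r, x) = 0" using supp[of r x] by (auto simp: indicator_def)
      thus ?thesis using B assms by (auto intro!: mult_nonneg_nonneg)
    qed
    show "?F (r, x) = 0" if "x \<notin> cball a d" for r x using supp[of r x] that by (auto simp: indicator_def)
  qed auto
  have e1: "(\<integral>r. indicator {e..d} r * (?c r * bump_laplacian r (x - a) * v x) \<partial>lborel)
      = (mean_kernel d (x - a) - mean_kernel e (x - a)) * v x" for x
  proof -
    have "(\<integral>r. indicator {e..d} r * (?c r * bump_laplacian r (x - a) * v x) \<partial>lborel)
        = (\<integral>r. indicator {e..d} r *\<^sub>R (?c r * bump_laplacian r (x - a)) * v x \<partial>lborel)"
      by (simp only: real_scaleR_def mult.assoc)
    also have "\<dots> = (\<integral>r. indicator {e..d} r *\<^sub>R (?c r * bump_laplacian r (x - a)) \<partial>lborel) * v x"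
      by (rule integral_mult_left_zero)
    finally show ?thesis
      using kernel_diff_eq_integral[OF assms, of "x - a"] by (simp only: set_lebesgue_integral_def)
  qed
  have e2: "(\<integral>x. indicator {e..d} r * (?c r * bump_laplacian r (x - a) * v x) \<partial>lborel)
      = indicator {e..d} r *\<^sub>R (?c r * riesz_mass a r)" for r
    unfolding riesz_mass_def by (simp only: real_scaleR_def mult.assoc integral_mult_right_zero)
  have "kernel_mean a d - kernel_mean a e = (\<integral>x. (mean_kernel d (x - a) - mean_kernel e (x - a)) * v x \<partial>lborel)"
    unfolding kernel_mean_def left_diff_distrib using assms integrable_kernel_mult
    by (subst Bochner_Integration.integral_diff) auto
  also have "\<dots> = (\<integral>x. (\<integral>r. indicator {e..d} r * (?c r * bump_laplacian r (x - a) * v x) \<partial>lborel) \<partial>lborel)"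
    by (simp only: e1)
  also have "\<dots> = (\<integral>r. (\<integral>x. indicator {e..d} r * (?c r * bump_laplacian r (x - a) * v x) \<partial>lborel) \<partial>lborel)"
    using lborel_pair.Fubini_integral[OF int] .
  finally show "kernel_mean a d - kernel_mean a e = (LINT r:{e..d}|lborel. ?c r * riesz_mass a r)"
    unfolding set_lebesgue_integral_def by (simp only: e2)
  show "set_integrable lborel {e..d} (\<lambda>r. ?c r * riesz_mass a r)"
    using lborel_pair.integrable_fst[OF int] unfolding set_integrable_def by (simp only: e2)
qed

end

definition kernel_mass :: "'n::finite itself \<Rightarrow> real" where
  "kernel_mass _ = (\<integral>x. mean_kernel 1 (x :: complex ^ 'n) \<partial>lborel)"

text \<open>
  The constants \<open>1\<close> and \<open>-1\<close> are both plurisubharmonic, so the integral is nonnegative for both signs.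
\<close>
lemma integral_bump_laplacian:
  assumes "0 < r"
  shows "(\<integral>x. bump_laplacian r (x - a :: complex ^ 'n) \<partial>lborel) = 0"
proof -
  interpret p: bounded_psh "\<lambda>x :: complex ^ 'n. 1" by (rule bounded_psh_const)
  interpret m: bounded_psh "\<lambda>x :: complex ^ 'n. - 1" by (rule bounded_psh_const)
  have nn: "0 \<le> (\<Sum>i\<in>{()}. 1 * bump r (x - a))" for x by (simp add: bump_def gap_nonneg)
  have p0: "0 \<le> (\<Sum>i\<in>{()}. 1 * p.riesz_mass a r)" by (rule p.riesz_mass_sum_nonneg) (use nn assms in simp_all)
  have m0: "0 \<le> (\<Sum>i\<in>{()}. 1 * m.riesz_mass a r)" by (rule m.riesz_mass_sum_nonneg) (use nn assms in simp_all)
  show ?thesis using p0 m0 by (simp add: p.riesz_mass_def m.riesz_mass_def)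
qed

text \<open>
  By \<open>kernel_mean_diff\<close> for the constant function \<open>1\<close>, whose Riesz mass is \<open>0\<close>, the integral does not
  depend on the radius.
\<close>
lemma integral_kernel:
  assumes "0 < r"
  shows "(\<integral>x. mean_kernel r (x - a :: complex ^ 'n) \<partial>lborel) = kernel_mass TYPE('n)"
proof -
  interpret p: bounded_psh "\<lambda>x :: complex ^ 'n. 1" by (rule bounded_psh_const)
  have z: "p.riesz_mass b s = 0" if "0 < s" for b s
    using integral_bump_laplacian[OF that, of b] by (simp add: p.riesz_mass_def)
  have eq: "p.kernel_mean a d = p.kernel_mean a e" if "0 < e" "e \<le> d" for d e
  proof -
    have "(LINT r:{e..d}|lborel. 2 / 3 / r ^ (2 * CARD('n) + 5) * p.riesz_mass a r) = (LINT r:{e..d}|lborel. 0)"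
      using that by (intro set_lebesgue_integral_cong) (auto simp: z)
    thus ?thesis using p.kernel_mean_diff(1)[OF that, of a] by simp
  qed
  have "p.kernel_mean a r = p.kernel_mean a 1" using eq[OF assms, of 1] eq[OF zero_less_one, of r] by (metis linear)
  also have "\<dots> = kernel_mass TYPE('n)"
    using integral_lborel_shift[of "\<lambda>x. mean_kernel 1 (x - a)" a] by (simp add: p.kernel_mean_def kernel_mass_def)
  finally show ?thesis by (simp add: p.kernel_mean_def)
qed

lemma kernel_mass_pos: "0 < kernel_mass TYPE('n::finite)"
proof -
  let ?b = "ball (0 :: complex ^ 'n) (1/2)"
  have "0 < 9 / 16 * measure lborel ?b" using content_ball_pos[of "1/2" "0 :: complex ^ 'n"] by simp
  also have "\<dots> = (\<integral>x. 9 / 16 * indicator ?b x \<partial>lborel)" by simp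
  also have "\<dots> \<le> kernel_mass TYPE('n)" unfolding kernel_mass_def
  proof (rule integral_mono)
    show "integrable lborel (\<lambda>x. 9 / 16 * indicat_real ?b x)"
      using emeasure_lborel_ball_finite[of "0 :: complex ^ 'n" "1/2"] by (intro integrable_mult_right integrable_real_indicator) auto
    show "integrable lborel (\<lambda>x. mean_kernel 1 (x :: complex ^ 'n))"
      using integrable_kernel[of 1 0] by simp
    show "9 / 16 * indicator ?b x \<le> mean_kernel 1 x" for x :: "complex ^ 'n"
    proof (cases "x \<in> ?b")
      case True
      hence "(norm x)\<^sup>2 \<le> (1/2)\<^sup>2" by (intro power_mono) auto
      hence "3 / 4 \<le> gap 1 x" by (simp add: gap_def power2_eq_square)
      hence "(3 / 4)\<^sup>2 \<le> (gap 1 x)\<^sup>2" by (intro power_mono) auto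
      thus ?thesis using True by (simp add: mean_kernel_def power2_eq_square)
    qed (simp add: kernel_nonneg)
  qed
  finally show ?thesis .
qed

context bounded_psh
begin

lemma submean_kernel:
  assumes "0 < r" shows "kernel_mass TYPE('n) * v a \<le> kernel_mean a r"
proof -
  have m: "mean_kernel r \<in> borel_measurable (borel :: (complex ^ 'n) measure)" using measurable_kernel[of r 0] by simp
  have bound: "\<bar>mean_kernel r x\<bar> \<le> 1 / r ^ (2 * CARD('n))" for x :: "complex ^ 'n"
    using kernel_nonneg[of r x] kernel_le[OF assms, of x] assms by simp
  have zero: "mean_kernel r x = 0" if "x \<notin> cball 0 r" for x :: "complex ^ 'n"
    using that assms by (intro kernel_eq_0) auto
  have nonneg: "0 \<le> mean_kernel r x" for x :: "complex ^ 'n" using assms by (simp add: kernel_nonneg)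
  have rot: "mean_kernel r (cis \<theta> *s x) = mean_kernel r x" for \<theta> and x :: "complex ^ 'n"
    by (simp add: mean_kernel_def gap_def norm_scalar_mult)
  show ?thesis
    using radial_submean[OF m bound zero nonneg rot, where a=a] integral_kernel[OF assms, of "0 :: complex ^ 'n"]
    by (simp add: kernel_mean_def mult.commute)
qed

text \<open>
  Upper semicontinuity bounds \<open>v\<close> from above near \<open>a\<close>, so small-scale averages cannot stay above
  \<open>v a\<close>.
\<close>
lemma le_of_kernel_mean_ge:
  assumes d: "0 < d" and ge: "\<And>e. 0 < e \<Longrightarrow> e \<le> d \<Longrightarrow> c \<le> kernel_mean a e"
  shows "c \<le> kernel_mass TYPE('n) * v a"
proof (rule ccontr)
  let ?k = "kernel_mass TYPE('n)"
  have k: "0 < ?k" by (rule kernel_mass_pos)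
  assume "\<not> ?thesis"
  hence "v a < c / ?k" using k by (simp add: field_simps)
  then obtain c' where c': "v a < c'" "c' < c / ?k" using dense by blast
  have "a \<in> {x. v x < c'}" using c' by simp
  then obtain e where e: "e > 0" "ball a e \<subseteq> {x. v x < c'}"
    using open_sublevel open_contains_ball by blast
  define s where "s = min d e"
  have s: "0 < s" "s \<le> d" "s \<le> e" using d e by (auto simp: s_def)
  have "kernel_mean a s \<le> (\<integral>x. mean_kernel s (x - a) * c' \<partial>lborel)"
    unfolding kernel_mean_def
  proof (rule integral_mono)
    show "integrable lborel (\<lambda>x. mean_kernel s (x - a) * v x)" using s by (intro integrable_kernel_mult)
    show "integrable lborel (\<lambda>x. mean_kernel s (x - a) * c')" using s by (intro integrable_mult_left integrable_kernel)
    show "mean_kernel s (x - a) * v x \<le> mean_kernel s (x - a) * c'" for x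
    proof (cases "x \<in> ball a s")
      case True
      hence "x \<in> ball a e" using s by auto
      hence "v x < c'" using e by blast
      thus ?thesis using s by (intro mult_left_mono kernel_nonneg) auto
    next
      case False
      hence "mean_kernel s (x - a) = 0" using s by (intro kernel_eq_0) (auto simp: dist_norm norm_minus_commute)
      thus ?thesis by simp
    qed
  qed
  also have "\<dots> = ?k * c'" using integral_kernel[OF s(1), of a] by simp
  also have "\<dots> < c" using c' k by (simp add: field_simps)
  finally show False using ge[of s] s by simp
qed

lemma lower_bound_of_riesz_mass_decay:
  assumes d: "0 < d" and \<alpha>: "0 < \<alpha>" and A: "0 \<le> A"
    and decay: "\<And>r. 0 < r \<Longrightarrow> r \<le> d \<Longrightarrow> riesz_mass a r \<le> A * r powr (2 * real CARD('n) + 4 + \<alpha>)"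
  shows "kernel_mean a d - 2 / 3 * A * d powr \<alpha> / \<alpha> \<le> kernel_mass TYPE('n) * v a"
proof (rule le_of_kernel_mean_ge[OF d])
  fix e assume e: "0 < e" "e \<le> d"
  have "kernel_mean a d - kernel_mean a e = (LINT r:{e..d}|lborel. 2 / 3 / r ^ (2 * CARD('n) + 5) * riesz_mass a r)"
    by (rule kernel_mean_diff(1)[OF e])
  also have "\<dots> \<le> (LINT r:{e..d}|lborel. 2 / 3 * A * r powr (\<alpha> - 1))"
  proof (rule set_integral_mono[OF kernel_mean_diff(2)[OF e]])
    show "set_integrable lborel {e..d} (\<lambda>r. 2 / 3 * A * r powr (\<alpha> - 1))"
      using e by (intro borel_integrable_atLeastAtMost' continuous_intros) auto
    fix r assume "r \<in> {e..d}"
    hence r: "0 < r" "r \<le> d" using e by auto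
    have "2 / 3 / r ^ (2 * CARD('n) + 5) * riesz_mass a r \<le> 2 / 3 / r ^ (2 * CARD('n) + 5) * (A * r powr (2 * real CARD('n) + 4 + \<alpha>))"
      using r decay by (intro mult_left_mono) auto
    also have "\<dots> = 2 / 3 * A * (r powr (2 * real CARD('n) + 4 + \<alpha>) / r ^ (2 * CARD('n) + 5))" by simp
    also have "r powr (2 * real CARD('n) + 4 + \<alpha>) / r ^ (2 * CARD('n) + 5) = r powr (\<alpha> - 1)"
    proof -
      have "r ^ (2 * CARD('n) + 5) = r powr (2 * real CARD('n) + 5)"
        using powr_realpow[OF r(1), of "2 * CARD('n) + 5"] by simp
      thus ?thesis by (simp add: powr_diff[symmetric])
    qed
    finally show "2 / 3 / r ^ (2 * CARD('n) + 5) * riesz_mass a r \<le> 2 / 3 * A * r powr (\<alpha> - 1)" .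
  qed
  also have "\<dots> = 2 / 3 * A * d powr \<alpha> / \<alpha> - 2 / 3 * A * e powr \<alpha> / \<alpha>"
  proof (rule set_integral_FTC[where F="\<lambda>r. 2 / 3 * A * r powr \<alpha> / \<alpha>"])
    show "((\<lambda>r. 2 / 3 * A * r powr \<alpha> / \<alpha>) has_real_derivative 2 / 3 * A * r powr (\<alpha> - 1)) (at r)"
      if "e \<le> r" "r \<le> d" for r
      using that e \<alpha> by (auto intro!: derivative_eq_intros)
    show "continuous_on {e..d} (\<lambda>r. 2 / 3 * A * r powr (\<alpha> - 1))"
      using e by (intro continuous_intros) auto
  qed (use e in auto)
  also have "\<dots> \<le> 2 / 3 * A * d powr \<alpha> / \<alpha>" using A \<alpha> by simp
  finally show "kernel_mean a d - 2 / 3 * A * d powr \<alpha> / \<alpha> \<le> kernel_mean a e" by simp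
qed

end

section \<open>The Bernstein-Walsh inequality\<close>

lemma ln_add_one_le_cubic:
  fixes x :: real
  assumes "-1 < x"
  shows "ln (1 + x) \<le> x - x\<^sup>2 / 2 + x ^ 3 / 3"
proof -
  define f where "f x = x - x\<^sup>2 / 2 + x ^ 3 / 3 - ln (1 + x)" for x :: real
  have D: "(f has_real_derivative x ^ 3 / (1 + x)) (at x)" if "-1 < x" for x
    unfolding f_def using that
    by (auto intro!: derivative_eq_intros simp: field_simps power2_eq_square power3_eq_cube)
  have "f 0 \<le> f x"
  proof (cases "0 \<le> x")
    case True
    show ?thesis
    proof (rule DERIV_nonneg_imp_nondecreasing[OF True])
      fix t assume "0 \<le> t" "t \<le> x"
      thus "\<exists>y. (f has_real_derivative y) (at t) \<and> 0 \<le> y"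
        using D[of t] by (intro exI[of _ "t ^ 3 / (1 + t)"]) auto
    qed
  next
    case False
    hence "x \<le> 0" by simp
    thus ?thesis
    proof (rule DERIV_nonpos_imp_nonincreasing)
      fix t assume "x \<le> t" "t \<le> 0"
      thus "\<exists>y. (f has_real_derivative y) (at t) \<and> y \<le> 0"
        using D[of t] assms by (intro exI[of _ "t ^ 3 / (1 + t)"]) (auto simp: divide_le_0_iff)
    qed
  qed
  thus ?thesis by (simp add: f_def)
qed

lemma one_minus_inverse_le_cubic:
  fixes x :: real
  assumes "-1 < x"
  shows "1 - 1 / (1 + x) \<le> x - x\<^sup>2 + x ^ 3"
proof -
  have "0 \<le> x ^ 4" by simp
  hence "(1 - (x - x\<^sup>2 + x ^ 3)) * (1 + x) \<le> 1"
    by (simp add: algebra_simps power2_eq_square power3_eq_cube power4_eq_xxxx)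
  hence "1 - (x - x\<^sup>2 + x ^ 3) \<le> 1 / (1 + x)" using assms by (simp add: field_simps)
  thus ?thesis by simp
qed

lemma circle_integral_cubic_bound:
  fixes A B E \<epsilon> :: real
  defines "q \<equiv> \<lambda>\<theta>. 2 * \<epsilon> * Re (1 * cis \<theta>) + \<epsilon>\<^sup>2"
  shows "(LINT \<theta>:{0..2*pi}|lborel. A * q \<theta> - B * (q \<theta>)\<^sup>2 + E) = 2 * pi * (A * \<epsilon>\<^sup>2 - B * (2 * \<epsilon>\<^sup>2 + \<epsilon> ^ 4) + E)"
    and "set_integrable lborel {0..2*pi} (\<lambda>\<theta>. A * q \<theta> - B * (q \<theta>)\<^sup>2 + E)"
proof -
  let ?c = "\<lambda>\<theta>. Re (1 * cis \<theta>)"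
  define q0 q1 q2 where "q0 = A * \<epsilon>\<^sup>2 - B * \<epsilon> ^ 4 + E" and "q1 = 2 * A * \<epsilon> - 4 * B * \<epsilon> ^ 3" and "q2 = - 4 * B * \<epsilon>\<^sup>2"
  have i0: "set_integrable lborel {0..2*pi} (\<lambda>\<theta>. q0)" and i1: "set_integrable lborel {0..2*pi} ?c"
    and i2: "set_integrable lborel {0..2*pi} (\<lambda>\<theta>. (?c \<theta>)\<^sup>2)"
    by (intro set_integrable_circle continuous_intros)+
  have "(\<lambda>\<theta>. A * q \<theta> - B * (q \<theta>)\<^sup>2 + E) = (\<lambda>\<theta>. q0 + q1 * ?c \<theta> + q2 * (?c \<theta>)\<^sup>2)"
    unfolding q_def q0_def q1_def q2_def by (intro ext) algebra
  hence "(LINT \<theta>:{0..2*pi}|lborel. A * q \<theta> - B * (q \<theta>)\<^sup>2 + E) = (LINT \<theta>:{0..2*pi}|lborel. q0 + q1 * ?c \<theta> + q2 * (?c \<theta>)\<^sup>2)" by simp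
  also have "\<dots> = (LINT \<theta>:{0..2*pi}|lborel. q0) + (LINT \<theta>:{0..2*pi}|lborel. q1 * ?c \<theta>) + (LINT \<theta>:{0..2*pi}|lborel. q2 * (?c \<theta>)\<^sup>2)"
    using i0 i1 i2 by (simp only: set_integral_add set_integrable_mult_right simp_thms)
  also have "\<dots> = 2 * pi * q0 + q2 * (pi * (cmod 1)\<^sup>2)"
    by (simp only: set_integral_mult_right circle_integral_const circle_integral_Re circle_integral_Re_squared mult_zero_right add_0_right)
  also have "\<dots> = 2 * pi * (A * \<epsilon>\<^sup>2 - B * (2 * \<epsilon>\<^sup>2 + \<epsilon> ^ 4) + E)"
    by (simp add: q0_def q2_def algebra_simps)
  finally show "(LINT \<theta>:{0..2*pi}|lborel. A * q \<theta> - B * (q \<theta>)\<^sup>2 + E) = 2 * pi * (A * \<epsilon>\<^sup>2 - B * (2 * \<epsilon>\<^sup>2 + \<epsilon> ^ 4) + E)" .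
  show "set_integrable lborel {0..2*pi} (\<lambda>\<theta>. A * q \<theta> - B * (q \<theta>)\<^sup>2 + E)"
    unfolding q_def by (intro set_integrable_circle continuous_intros)
qed

context bounded_psh
begin

lemma integrable_on_circle: "set_integrable lborel {0..2*pi} (\<lambda>\<theta>. v (a + cis \<theta> *s b))"
proof -
  obtain B where B: "B \<ge> 0" "\<And>x. x \<in> cball a (norm b) \<Longrightarrow> \<bar>v x\<bar> \<le> B" using bounded_on_cball by blast
  have in': "a + cis \<theta> *s b \<in> cball a (norm b)" for \<theta> by (simp add: dist_norm norm_scalar_mult)
  have "(\<lambda>\<theta>. a + cis \<theta> *s b) \<in> borel_measurable borel"
    by (intro borel_measurable_continuous_onI continuous_intros)
  hence [measurable]: "(\<lambda>\<theta>. v (a + cis \<theta> *s b)) \<in> borel_measurable borel"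
    by (rule measurable_compose) measurable
  show ?thesis unfolding set_integrable_def
    by (rule integrable_bounded_support[where a=pi and R=pi and B=B])
       (use B(2)[OF in'] B(1) in \<open>auto simp: indicator_def dist_real_def\<close>)
qed

text \<open>
  Maximum principle on the exterior of \<open>cball a r\<close>. With \<open>w = |x - a| / r\<close>, the comparison function is
  \<open>H = (1 + \<tau>) ln w + \<tau> (1 - 1 / w\<^sup>2)\<close>: the factor \<open>1 + \<tau>\<close> makes it outgrow \<open>v\<close> at infinity, and
  the second term makes it strictly superharmonic on complex lines through \<open>a\<close>. If \<open>v - H\<close> exceeded \<open>m\<close>
  somewhere outside the ball, it would attain its maximum at some \<open>z0\<close> there; on a small circle around \<open>z0\<close> in the
  line through \<open>a\<close> and \<open>z0\<close>, the mean of \<open>v\<close> would then fall short of \<open>v z0\<close>.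
\<close>
lemma bernstein_walsh_strict:
  assumes growth: "\<And>x. v x \<le> log_plus (norm x) + M" and r: "0 < r"
    and m: "\<And>x. x \<in> cball a r \<Longrightarrow> v x \<le> m" and z: "r \<le> norm (z - a)" and \<tau>: "0 < \<tau>"
  shows "v z \<le> m + (1 + \<tau>) * ln (norm (z - a) / r) + \<tau>"
proof (rule ccontr)
  \<comment> \<open>Truncating at \<open>1\<close> makes \<open>H\<close> continuous on the whole space, with \<open>H = 0\<close> on \<open>cball a r\<close>.\<close>
  define s where "s x = (max 1 (norm (x - a) / r))\<^sup>2" for x
  define H where "H x = (1 + \<tau>) / 2 * ln (s x) + \<tau> * (1 - 1 / s x)" for x
  have s1: "1 \<le> s x" for x by (simp add: s_def)
  have s_far: "s x = (norm (x - a) / r)\<^sup>2" if "r \<le> norm (x - a)" for x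
    using that r by (simp add: s_def max_def)
  have ln_s: "ln (s x) = 2 * ln (norm (x - a) / r)" if "r \<le> norm (x - a)" for x
  proof -
    have "0 < norm (x - a) / r" using that r by (intro divide_pos_pos) linarith+
    thus ?thesis unfolding s_far[OF that] by (simp add: ln_realpow)
  qed
  have H_lower: "(1 + \<tau>) * ln (norm (x - a) / r) \<le> H x" if "r \<le> norm (x - a)" for x
    using ln_s[OF that] s1[of x] \<tau> by (simp add: H_def field_simps)
  have H_upper: "H x \<le> (1 + \<tau>) * ln (norm (x - a) / r) + \<tau>" if "r \<le> norm (x - a)" for x
    using ln_s[OF that] s1[of x] \<tau> by (simp add: H_def field_simps)
  have H_nonneg: "0 \<le> H x" for x using s1[of x] \<tau> by (auto simp: H_def)
  have "continuous_on UNIV s" unfolding s_def using r by (intro continuous_intros) auto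
  moreover have "s x \<noteq> 0" for x using s1[of x] by linarith
  ultimately have H_cont: "continuous_on UNIV H" unfolding H_def by (intro continuous_intros) auto
  define D where "D x = v x - H x" for x
  have D_usc: "open {x. D x < c}" for c
  proof -
    have "{x. D x < c} = (\<Union>q. {x. v x < q} \<inter> {x. q - c < H x})"
    proof (intro equalityI subsetI)
      fix x assume "x \<in> {x. D x < c}"
      hence "v x < (v x + (c + H x)) / 2" "(v x + (c + H x)) / 2 - c < H x" by (auto simp: D_def field_simps)
      thus "x \<in> (\<Union>q. {x. v x < q} \<inter> {x. q - c < H x})" by blast
    qed (auto simp: D_def)
    thus ?thesis
      using open_sublevel open_Collect_less[OF continuous_on_const H_cont] by (simp only: open_UN open_Int UNIV_I ball_simps simp_thms)
  qed
  assume "\<not> ?thesis"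
  hence Dz: "m < D z" using H_upper[OF z] by (simp add: D_def)
  define L where "L = ln (1 + r + norm a)"
  define \<rho> where "\<rho> = max 1 (exp ((L + M - m) / \<tau>))"
  have far: "D x \<le> m" if "\<rho> * r \<le> norm (x - a)" for x
  proof -
    define w where "w = norm (x - a) / r"
    have nx: "norm (x - a) = w * r" using r by (simp add: w_def)
    have "\<rho> \<le> w" using that r by (simp add: nx)
    hence w: "1 \<le> w" "exp ((L + M - m) / \<tau>) \<le> w" by (auto simp: \<rho>_def)
    have "(L + M - m) / \<tau> \<le> ln w" using w by (subst ln_ge_iff) linarith+
    hence lw: "L + M - m \<le> \<tau> * ln w" using \<tau> by (simp add: divide_le_eq mult.commute)
    have "norm x \<le> w * r + norm a" using norm_triangle_ineq[of "x - a" a] by (simp add: nx)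
    also have "\<dots> \<le> w * (1 + r + norm a)" using w(1) mult_right_mono[OF w(1), of "norm a"] by (simp add: algebra_simps)
    finally have "norm x \<le> w * (1 + r + norm a)" .
    moreover have "1 \<le> w * (1 + r + norm a)" using mult_mono[OF w(1), of 1 "1 + r + norm a"] r w(1) by simp
    ultimately have "max 1 (norm x) \<le> w * (1 + r + norm a)" by simp
    hence "log_plus (norm x) \<le> ln (w * (1 + r + norm a))" unfolding log_plus_def by (intro ln_mono) auto
    also have "\<dots> = ln w + L" using w(1) r by (subst ln_mult_pos) (auto simp: L_def add_pos_nonneg intro: add_pos_nonneg)
    finally have "v x \<le> ln w + L + M" using growth[of x] by simp
    moreover have "r \<le> norm (x - a)" using w(1) r by (simp add: nx)
    from H_lower[OF this, folded w_def] have "ln w + \<tau> * ln w \<le> H x" by (simp add: algebra_simps)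
    ultimately show ?thesis using lw by (simp add: D_def)
  qed
  obtain z0 where z0: "\<And>x. x \<in> cball a (\<rho> * r) \<Longrightarrow> D x \<le> D z0" "z0 \<in> cball a (\<rho> * r)"
  proof (rule usc_attains_max[of "cball a (\<rho> * r)" D])
    have "0 \<le> \<rho> * r" using r by (auto simp: \<rho>_def intro!: mult_nonneg_nonneg)
    thus "cball a (\<rho> * r) \<noteq> {}" by simp
  qed (use D_usc in auto)
  have "norm (z - a) \<le> \<rho> * r" using far[of z] Dz by linarith
  hence "D z \<le> D z0" by (intro z0) (simp add: dist_norm norm_minus_commute)
  with Dz have Dz0: "m < D z0" by simp
  have max: "D x \<le> D z0" for x
  proof (cases "norm (x - a) \<le> \<rho> * r")
    case True thus ?thesis by (intro z0) (simp add: dist_norm norm_minus_commute)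
  next
    case False thus ?thesis using far[of x] Dz0 by linarith
  qed
  have out: "r < norm (z0 - a)"
  proof (rule ccontr)
    assume "\<not> ?thesis"
    hence "v z0 \<le> m" by (intro m) (simp add: dist_norm norm_minus_commute)
    thus False using Dz0 H_nonneg[of z0] by (simp add: D_def)
  qed
  define s0 where "s0 = s z0"
  have s0: "1 \<le> s0" "s0 = (norm (z0 - a) / r)\<^sup>2" using s1[of z0] s_far[of z0] out unfolding s0_def by linarith+
  define t where "t = \<tau> / s0"
  \<comment> \<open>\<open>A q - B q\<^sup>2\<close> is the second-order part of \<open>H\<close> along the circle, where \<open>1 + q\<close> is the factor by
    which \<open>|x - a|\<^sup>2\<close> changes. Its mean is about \<open>(A - 2 B) \<epsilon>\<^sup>2 = - t \<epsilon>\<^sup>2\<close>; the term \<open>t\<close> comes from the strictly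
    superharmonic part of \<open>H\<close>. The bound on \<open>\<epsilon>\<close> keeps the circle outside the ball and the cubic
    remainder below \<open>t \<epsilon>\<^sup>2\<close>.\<close>
  define A B where "A = (1 + \<tau>) / 2 + t" and "B = (1 + \<tau>) / 4 + t"
  have t0: "0 < t" unfolding t_def using \<tau> s0(1) by simp
  have A0: "0 < A" "0 \<le> B" "A - 2 * B = - t"
  proof -
    show "0 < A" unfolding A_def using t0 \<tau> by (intro add_pos_pos) auto
    show "0 \<le> B" unfolding B_def using t0 \<tau> by (intro add_nonneg_nonneg) auto
    show "A - 2 * B = - t" unfolding A_def B_def by (simp add: field_simps)
  qed
  define \<epsilon> where "\<epsilon> = min (min (1/2) (1 - r / norm (z0 - a))) (t / (28 * A))"
  have \<epsilon>: "0 < \<epsilon>" "\<epsilon> \<le> 1/2" "\<epsilon> \<le> 1 - r / norm (z0 - a)" "28 * A * \<epsilon> \<le> t"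
  proof -
    have "0 < 1 - r / norm (z0 - a)" using out r by (simp add: divide_less_eq)
    thus "0 < \<epsilon>" using t0 A0(1) by (simp add: \<epsilon>_def)
    have le: "\<epsilon> \<le> min (1/2) (1 - r / norm (z0 - a))" unfolding \<epsilon>_def by (rule min.cobounded1)
    show "\<epsilon> \<le> 1/2" by (rule order_trans[OF le min.cobounded1])
    show "\<epsilon> \<le> 1 - r / norm (z0 - a)" by (rule order_trans[OF le min.cobounded2])
    have "\<epsilon> \<le> t / (28 * A)" unfolding \<epsilon>_def by (rule min.cobounded2)
    thus "28 * A * \<epsilon> \<le> t" using A0 by (simp add: field_simps)
  qed
  define q where "q \<theta> = 2 * \<epsilon> * Re (1 * cis \<theta>) + \<epsilon>\<^sup>2" for \<theta>
  define b where "b = of_real \<epsilon> *s (z0 - a)"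
  have pt: "v (z0 + cis \<theta> *s b) \<le> A * q \<theta> - B * (q \<theta>)\<^sup>2 + (27 * A * \<epsilon> ^ 3 + v z0)" for \<theta>
  proof -
    let ?x = "z0 + cis \<theta> *s b"
    have "?x - a = (1 + of_real \<epsilon> * cis \<theta>) *s (z0 - a)"
      by (simp add: b_def vec_eq_iff algebra_simps)
    hence nx: "norm (?x - a) = cmod (1 + of_real \<epsilon> * cis \<theta>) * norm (z0 - a)" by (simp only: norm_scalar_mult)
    have "(cmod (1 + of_real \<epsilon> * cis \<theta>))\<^sup>2 = (1 + \<epsilon> * cos \<theta>)\<^sup>2 + (\<epsilon> * sin \<theta>)\<^sup>2" by (simp add: cmod_power2)
    also have "\<dots> = 1 + 2 * \<epsilon> * cos \<theta> + \<epsilon>\<^sup>2 * ((cos \<theta>)\<^sup>2 + (sin \<theta>)\<^sup>2)" by algebra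
    finally have c2: "(cmod (1 + of_real \<epsilon> * cis \<theta>))\<^sup>2 = 1 + q \<theta>" by (simp add: q_def)
    have "1 - \<epsilon> \<le> cmod (1 + of_real \<epsilon> * cis \<theta>)"
      using norm_triangle_ineq2[of 1 "- (of_real \<epsilon> * cis \<theta>)"] \<epsilon>(1) by (simp add: norm_mult)
    hence c1: "1 - \<epsilon> \<le> cmod (1 + of_real \<epsilon> * cis \<theta>)" "0 < cmod (1 + of_real \<epsilon> * cis \<theta>)" using \<epsilon> by auto
    have "0 < (cmod (1 + of_real \<epsilon> * cis \<theta>))\<^sup>2" using c1(2) by (rule zero_less_power)
    hence q1: "-1 < q \<theta>" using c2 by linarith
    have "norm (z0 - a) \<noteq> 0" using out r by linarith
    hence "r = (1 - (1 - r / norm (z0 - a))) * norm (z0 - a)" by simp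
    also have "\<dots> \<le> (1 - \<epsilon>) * norm (z0 - a)" using \<epsilon> by (intro mult_right_mono) auto
    also have "\<dots> \<le> norm (?x - a)" unfolding nx using c1 by (intro mult_right_mono) auto
    finally have "s ?x = (norm (?x - a) / r)\<^sup>2" by (rule s_far)
    also have "\<dots> = (1 + q \<theta>) * s0"
      unfolding nx s0(2) c2[symmetric] by (simp add: power_divide power_mult_distrib)
    finally have sx: "s ?x = (1 + q \<theta>) * s0" .
    have "D ?x \<le> D z0" by (rule max)
    hence "v ?x \<le> v z0 + (H ?x - H z0)" by (simp add: D_def)
    also have "H ?x - H z0 = (1 + \<tau>) / 2 * ln (1 + q \<theta>) + t * (1 - 1 / (1 + q \<theta>))"
    proof -
      have "(1 + \<tau>) / 2 * ln (y * s0) + \<tau> * (1 - 1 / (y * s0)) - ((1 + \<tau>) / 2 * ln s0 + \<tau> * (1 - 1 / s0))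
         = (1 + \<tau>) / 2 * ln y + \<tau> / s0 * (1 - 1 / y)" if "0 < y" "0 < s0" for y s0
        using that by (simp add: ln_mult_pos field_simps)
      from this[of "1 + q \<theta>" s0] show ?thesis
        using q1 s0(1) unfolding H_def sx t_def s0_def[symmetric] by simp
    qed
    also have "\<dots> \<le> (1 + \<tau>) / 2 * (q \<theta> - (q \<theta>)\<^sup>2 / 2 + q \<theta> ^ 3 / 3) + t * (q \<theta> - (q \<theta>)\<^sup>2 + q \<theta> ^ 3)"
      by (intro add_mono mult_left_mono ln_add_one_le_cubic one_minus_inverse_le_cubic q1) (use t0 \<tau> in auto)
    also have "\<dots> = A * q \<theta> - B * (q \<theta>)\<^sup>2 + ((1 + \<tau>) / 6 + t) * q \<theta> ^ 3"
      by (simp add: A_def B_def field_simps)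
    also have "((1 + \<tau>) / 6 + t) * q \<theta> ^ 3 \<le> A * (27 * \<epsilon> ^ 3)"
    proof -
      have "\<bar>q \<theta>\<bar> \<le> 3 * \<epsilon>"
      proof -
        have "\<bar>\<epsilon> * cos \<theta>\<bar> \<le> \<epsilon>" using \<epsilon>(1) abs_cos_le_one[of \<theta>] by (simp add: abs_mult mult_left_le)
        moreover have "\<epsilon>\<^sup>2 \<le> \<epsilon>" "0 \<le> \<epsilon>\<^sup>2" using \<epsilon> by (auto simp: power2_eq_square mult_left_le)
        moreover have "\<bar>2 * p + e\<bar> \<le> 3 * \<epsilon>" if "\<bar>p\<bar> \<le> \<epsilon>" "e \<le> \<epsilon>" "0 \<le> e" for p e
          using that by linarith
        ultimately have "\<bar>2 * (\<epsilon> * cos \<theta>) + \<epsilon>\<^sup>2\<bar> \<le> 3 * \<epsilon>" by blast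
        thus ?thesis by (simp add: q_def mult.assoc)
      qed
      hence "\<bar>q \<theta>\<bar> ^ 3 \<le> (3 * \<epsilon>) ^ 3" by (intro power_mono) auto
      hence q3: "\<bar>q \<theta> ^ 3\<bar> \<le> 27 * \<epsilon> ^ 3" by (simp add: power_mult_distrib power_abs)
      have "((1 + \<tau>) / 6 + t) * q \<theta> ^ 3 \<le> ((1 + \<tau>) / 6 + t) * (27 * \<epsilon> ^ 3)"
        using q3 t0 \<tau> by (intro mult_left_mono) auto
      also have "\<dots> \<le> A * (27 * \<epsilon> ^ 3)" using \<epsilon> \<tau> by (intro mult_right_mono) (auto simp: A_def)
      finally show ?thesis .
    qed
    finally show ?thesis by simp
  qed
  have "2 * pi * v z0 \<le> (LINT \<theta>:{0..2*pi}|lborel. v (z0 + cis \<theta> *s b))" by (rule circle_submean)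
  also have "\<dots> \<le> (LINT \<theta>:{0..2*pi}|lborel. A * q \<theta> - B * (q \<theta>)\<^sup>2 + (27 * A * \<epsilon> ^ 3 + v z0))"
    using pt integrable_on_circle unfolding q_def by (intro set_integral_mono circle_integral_cubic_bound(2)) auto
  also have "\<dots> = 2 * pi * (A * \<epsilon>\<^sup>2 - B * (2 * \<epsilon>\<^sup>2 + \<epsilon> ^ 4) + (27 * A * \<epsilon> ^ 3 + v z0))"
    unfolding q_def by (rule circle_integral_cubic_bound(1))
  finally have "0 \<le> A * \<epsilon>\<^sup>2 - B * (2 * \<epsilon>\<^sup>2 + \<epsilon> ^ 4) + 27 * A * \<epsilon> ^ 3" by simp
  also have "\<dots> = (A - 2 * B) * \<epsilon>\<^sup>2 + 27 * A * \<epsilon> * \<epsilon>\<^sup>2 - B * \<epsilon> ^ 4"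
    by (simp add: algebra_simps power2_eq_square power3_eq_cube)
  also have "\<dots> \<le> - t * \<epsilon>\<^sup>2 + 27 * A * \<epsilon> * \<epsilon>\<^sup>2" using A0 by simp
  also have "\<dots> = (27 * A * \<epsilon> - t) * \<epsilon>\<^sup>2" by (simp add: algebra_simps)
  finally have "0 \<le> 27 * A * \<epsilon> - t" using \<epsilon>(1) by (simp add: zero_le_mult_iff)
  moreover have "27 * A * \<epsilon> < 28 * A * \<epsilon>" using A0 \<epsilon>(1) by simp
  ultimately show False using \<epsilon>(4) by linarith
qed

lemma bernstein_walsh:
  assumes growth: "\<And>x. v x \<le> log_plus (norm x) + M" and r: "0 < r"
    and m: "\<And>x. x \<in> cball a r \<Longrightarrow> v x \<le> m"
  shows "v z \<le> m + log_plus (norm (z - a) / r)"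
proof (cases "r \<le> norm (z - a)")
  case True
  let ?l = "ln (norm (z - a) / r)"
  have "((\<lambda>\<tau>. m + (1 + \<tau>) * ?l + \<tau>) \<longlongrightarrow> m + (1 + 0) * ?l + 0) (at_right 0)"
    by (intro tendsto_intros)
  moreover have "\<forall>\<^sub>F \<tau> in at_right 0. v z \<le> m + (1 + \<tau>) * ?l + \<tau>"
    unfolding eventually_at_right_field using bernstein_walsh_strict[OF assms True] by (intro exI[of _ 1]) auto
  ultimately have "v z \<le> m + (1 + 0) * ?l + 0" by (rule tendsto_lowerbound) simp
  thus ?thesis using True r by (simp add: log_plus_def max_def)
next
  case False
  hence "v z \<le> m" by (intro m) (simp add: dist_norm norm_minus_commute)
  moreover have "0 \<le> log_plus (norm (z - a) / r)" by (simp add: log_plus_def)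
  ultimately show ?thesis by simp
qed

end

section \<open>Averages at small scales and the total mass\<close>

lemma mean_kernel_ge:
  fixes x :: "complex ^ 'n"
  assumes \<rho>: "0 < \<rho>" and x: "norm x \<le> 2 / 3 * \<rho>"
  shows "1 \<le> 4 * \<rho> ^ (2 * CARD('n)) * mean_kernel \<rho> x"
proof -
  have "(norm x)\<^sup>2 \<le> (2 / 3 * \<rho>)\<^sup>2" using x by (intro power_mono) auto
  hence "5 / 9 * \<rho>\<^sup>2 \<le> \<rho>\<^sup>2 - (norm x)\<^sup>2" by (simp add: power2_eq_square)
  also have "\<dots> \<le> gap \<rho> x" by (simp add: gap_def)
  finally have "5 / 9 * \<rho>\<^sup>2 \<le> gap \<rho> x" .
  hence "(5 / 9 * \<rho>\<^sup>2)\<^sup>2 \<le> (gap \<rho> x)\<^sup>2" by (intro power_mono) auto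
  moreover have "(5 / 9 * \<rho>\<^sup>2)\<^sup>2 = 25 / 81 * \<rho> ^ 4" by (simp add: power2_eq_square power4_eq_xxxx)
  moreover have "0 \<le> (gap \<rho> x)\<^sup>2" by simp
  ultimately have g: "\<rho> ^ 4 \<le> 4 * (gap \<rho> x)\<^sup>2" by linarith
  have "4 * \<rho> ^ (2 * CARD('n)) * mean_kernel \<rho> x = 4 * (gap \<rho> x)\<^sup>2 / \<rho> ^ 4"
    using \<rho> by (simp add: mean_kernel_def power_add)
  also have "1 \<le> \<dots>" using g \<rho> by simp
  finally show ?thesis .
qed

context bounded_psh
begin

text \<open>
  Where \<open>v \<le> m\<close>, the function \<open>m - v\<close> is nonnegative, and its kernel mean around \<open>b\<close> is at most a multiple of
  \<open>m - v b \<le> c\<close>. So \<open>v\<close> is close to \<open>m\<close> in \<open>L\<^sup>1\<close> on the part of the ball where the kernel is bounded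
  below, and \<open>m\<close> may replace \<open>v\<close> in integrals supported there.
\<close>
lemma integral_near_max:
  fixes g :: "complex ^ 'n \<Rightarrow> real"
  assumes \<rho>: "0 < \<rho>" and m: "\<And>x. x \<in> cball b \<rho> \<Longrightarrow> v x \<le> m" and c: "m - c \<le> v b"
    and g[measurable]: "g \<in> borel_measurable borel" and G: "\<And>x. \<bar>g x\<bar> \<le> G"
    and supp: "\<And>x. x \<notin> cball b (2 / 3 * \<rho>) \<Longrightarrow> g x = 0"
  shows "\<bar>m * (\<integral>x. g x \<partial>lborel) - (\<integral>x. g x * v x \<partial>lborel)\<bar> \<le> 4 * G * \<rho> ^ (2 * CARD('n)) * kernel_mass TYPE('n) * c"
proof -
  let ?K = "4 * G * \<rho> ^ (2 * CARD('n))"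
  have G0: "0 \<le> G" using G[of b] by linarith
  have ig: "integrable lborel g"
    by (rule integrable_bounded_support[OF g G supp])
  have igv: "integrable lborel (\<lambda>x. g x * v x)"
    by (rule integrable_weighted[OF g G supp])
  have "m * (\<integral>x. g x \<partial>lborel) - (\<integral>x. g x * v x \<partial>lborel) = (\<integral>x. m * g x - g x * v x \<partial>lborel)"
    using ig igv by simp
  also have "\<bar>\<dots>\<bar> \<le> (\<integral>x. ?K * (m * mean_kernel \<rho> (x - b) - mean_kernel \<rho> (x - b) * v x) \<partial>lborel)"
  proof (rule order_trans[OF integral_abs_bound integral_mono])
    show "integrable lborel (\<lambda>x. \<bar>m * g x - g x * v x\<bar>)" using ig igv by (intro integrable_abs) simp
    show "integrable lborel (\<lambda>x. ?K * (m * mean_kernel \<rho> (x - b) - mean_kernel \<rho> (x - b) * v x))"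
      using integrable_kernel[OF \<rho>, of b] integrable_kernel_mult[OF \<rho>, of b] by simp
    fix x
    have "\<bar>g x * (m - v x)\<bar> \<le> ?K * mean_kernel \<rho> (x - b) * (m - v x)"
    proof (cases "x \<in> cball b \<rho>")
      case True
      have "\<bar>g x\<bar> \<le> ?K * mean_kernel \<rho> (x - b)"
      proof (cases "x \<in> cball b (2 / 3 * \<rho>)")
        case True
        have "\<bar>g x\<bar> \<le> G * 1" using G by simp
        also have "\<dots> \<le> G * (4 * \<rho> ^ (2 * CARD('n)) * mean_kernel \<rho> (x - b))"
          using True G0 \<rho> by (intro mult_left_mono mean_kernel_ge) (auto simp: dist_norm norm_minus_commute)
        finally show ?thesis by (simp add: mult_ac)
      next
        case False
        thus ?thesis using supp[OF False] G0 \<rho> kernel_nonneg[of \<rho> "x - b"] by simp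
      qed
      moreover have "0 \<le> m - v x" using m[OF True] by simp
      ultimately show ?thesis unfolding abs_mult by (simp add: mult_right_mono)
    next
      case False
      hence "g x = 0" "mean_kernel \<rho> (x - b) = 0" using supp[of x] \<rho>
        by (auto intro!: kernel_eq_0 simp: dist_norm norm_minus_commute)
      thus ?thesis by simp
    qed
    thus "\<bar>m * g x - g x * v x\<bar> \<le> ?K * (m * mean_kernel \<rho> (x - b) - mean_kernel \<rho> (x - b) * v x)"
      by (simp add: algebra_simps)
  qed
  also have "\<dots> = ?K * (m * kernel_mass TYPE('n) - kernel_mean b \<rho>)"
    unfolding kernel_mean_def integral_kernel[OF \<rho>, of b, symmetric]
    using integrable_kernel[OF \<rho>, of b] integrable_kernel_mult[OF \<rho>, of b] by simp
  also have "\<dots> \<le> ?K * (kernel_mass TYPE('n) * c)"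
  proof (rule mult_left_mono)
    have "m * kernel_mass TYPE('n) - kernel_mean b \<rho> \<le> kernel_mass TYPE('n) * (m - v b)"
      using submean_kernel[OF \<rho>, of b] by (simp add: algebra_simps)
    also have "\<dots> \<le> kernel_mass TYPE('n) * c"
      using c kernel_mass_pos[where 'n='n] by (intro mult_left_mono) auto
    finally show "m * kernel_mass TYPE('n) - kernel_mean b \<rho> \<le> kernel_mass TYPE('n) * c" .
    show "0 \<le> ?K" using G0 \<rho> by simp
  qed
  finally show ?thesis by (simp add: mult_ac)
qed

text \<open>
  At a maximum point \<open>b\<close> of \<open>v\<close> on \<open>cball a \<delta>\<close>, the Bernstein-Walsh inequality gives
  \<open>v w \<le> v b + ln (2 / \<delta>)\<close> on the unit ball and \<open>v \<le> v b + ln 4\<close> on \<open>cball b (3 * \<delta>)\<close>. The latter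
  contains the support of the kernel around \<open>a\<close>, which makes its mean comparable to \<open>v b\<close>.
\<close>
lemma kernel_mean_lower_bound:
  assumes growth: "\<And>x. v x \<le> log_plus (norm x) + M" and \<delta>: "0 < \<delta>" "\<delta> \<le> 1"
    and a: "norm a \<le> 1" and w: "norm w \<le> 1"
  shows "kernel_mass TYPE('n) * (v w - ln (2 / \<delta>) - 4 * 9 ^ CARD('n) * ln 4) \<le> kernel_mean a \<delta>"
proof -
  let ?k = "kernel_mass TYPE('n)"
  have k: "0 < ?k" by (rule kernel_mass_pos)
  have "cball a \<delta> \<noteq> {}" using \<delta> by simp
  from usc_attains_max[OF compact_cball this, of v] open_sublevel
  obtain b where b: "b \<in> cball a \<delta>" and max: "\<And>x. x \<in> cball a \<delta> \<Longrightarrow> v x \<le> v b" by metis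
  have bw: "v x \<le> v b + log_plus (norm (x - a) / \<delta>)" for x
    by (rule bernstein_walsh[OF growth \<delta>(1) max])
  have "log_plus (norm (w - a) / \<delta>) \<le> ln (2 / \<delta>)"
  proof -
    have "norm (w - a) \<le> 2" using norm_triangle_ineq4[of w a] a w by linarith
    hence "norm (w - a) / \<delta> \<le> 2 / \<delta>" using \<delta> by (simp add: divide_right_mono)
    moreover have "1 \<le> 2 / \<delta>" using \<delta> by simp
    ultimately show ?thesis unfolding log_plus_def by (intro ln_mono) auto
  qed
  hence vb: "v w - ln (2 / \<delta>) \<le> v b" using bw[of w] by linarith
  have up: "v x \<le> v b + ln 4" if "x \<in> cball b (3 * \<delta>)" for x
  proof -
    have "norm (x - a) \<le> norm (x - b) + norm (b - a)" by norm
    hence "norm (x - a) / \<delta> \<le> 4" using that b \<delta> by (simp add: dist_norm norm_minus_commute divide_le_eq)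
    hence "log_plus (norm (x - a) / \<delta>) \<le> ln 4" unfolding log_plus_def by (intro ln_mono) auto
    thus ?thesis using bw[of x] by linarith
  qed
  have "\<bar>(v b + ln 4) * (\<integral>x. mean_kernel \<delta> (x - a) \<partial>lborel) - (\<integral>x. mean_kernel \<delta> (x - a) * v x \<partial>lborel)\<bar>
     \<le> 4 * (1 / \<delta> ^ (2 * CARD('n))) * (3 * \<delta>) ^ (2 * CARD('n)) * ?k * ln 4"
  proof (rule integral_near_max[OF _ up, where c="ln 4" and g="\<lambda>x. mean_kernel \<delta> (x - a)"])
    show "mean_kernel \<delta> (x - a) = 0" if "x \<notin> cball b (2 / 3 * (3 * \<delta>))" for x
    proof (rule kernel_eq_0)
      have "norm (x - b) \<le> norm (x - a) + norm (b - a)" by norm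
      thus "x - a \<notin> ball 0 \<delta>" using that b by (simp add: dist_norm norm_minus_commute)
    qed (use \<delta> in auto)
    show "\<bar>mean_kernel \<delta> (x - a)\<bar> \<le> 1 / \<delta> ^ (2 * CARD('n))" for x
      using kernel_nonneg[of \<delta> "x - a"] kernel_le[of \<delta> "x - a"] \<delta> by simp
  qed (use \<delta> in auto)
  also have "4 * (1 / \<delta> ^ (2 * CARD('n))) * (3 * \<delta>) ^ (2 * CARD('n)) = 4 * 9 ^ CARD('n)"
    using \<delta> by (simp add: power_mult_distrib power_mult)
  finally have "(v b + ln 4) * ?k - kernel_mean a \<delta> \<le> 4 * 9 ^ CARD('n) * ?k * ln 4"
    using integral_kernel[OF \<delta>(1), of a] unfolding kernel_mean_def by simp
  moreover have "?k * (v w - ln (2 / \<delta>)) \<le> ?k * (v b + ln 4)" using vb k by (intro mult_left_mono) (auto intro: add_increasing2)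
  ultimately show ?thesis by (simp add: algebra_simps)
qed

text \<open>
  The Laplacian of the bump has integral \<open>0\<close>, so a constant may be subtracted from \<open>v\<close>. Subtract an upper
  bound close to the maximum over the unit ball.
\<close>
lemma riesz_mass_upper_bound:
  assumes growth: "\<And>x. v x \<le> log_plus (norm x) + M"
  shows "riesz_mass 0 4 \<le> 4 * ((6 + 3 * real CARD('n)) * 4 ^ 4) * 9 ^ (2 * CARD('n)) * kernel_mass TYPE('n) * ln 10"
proof -
  have "cball (0 :: complex ^ 'n) 1 \<noteq> {}" by simp
  from usc_attains_max[OF compact_cball this, of v] open_sublevel
  obtain b where b: "b \<in> cball 0 1" and max: "\<And>x. x \<in> cball 0 1 \<Longrightarrow> v x \<le> v b" by metis
  have bw: "v x \<le> v b + log_plus (norm (x - 0) / 1)" for x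
    by (rule bernstein_walsh[OF growth _ max]) auto
  have up: "v x \<le> v b + ln 10" if "x \<in> cball b 9" for x
  proof -
    have "norm x \<le> norm (x - b) + norm b" by norm
    hence "norm x \<le> 10" using that b by (simp add: dist_norm norm_minus_commute)
    hence "log_plus (norm x) \<le> ln 10" unfolding log_plus_def by (intro ln_mono) auto
    thus ?thesis using bw[of x] by simp
  qed
  have "\<bar>(v b + ln 10) * (\<integral>x. bump_laplacian 4 (x - 0 :: complex ^ 'n) \<partial>lborel) - (\<integral>x. bump_laplacian 4 (x - 0) * v x \<partial>lborel)\<bar>
     \<le> 4 * ((6 + 3 * real CARD('n)) * 4 ^ 4) * 9 ^ (2 * CARD('n)) * kernel_mass TYPE('n) * ln 10"
  proof (rule integral_near_max[OF _ up, where c="ln 10" and g="\<lambda>x. bump_laplacian 4 (x - 0)"])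
    show "bump_laplacian 4 (x - 0) = 0" if "x \<notin> cball b (2 / 3 * 9)" for x
    proof (rule bump_laplacian_eq_0)
      have "norm (x - b) \<le> norm x + norm b" by norm
      thus "x - 0 \<notin> ball 0 4" using that b by (simp add: dist_norm norm_minus_commute)
    qed auto
  qed (use measurable_bump_laplacian[of 4 0] in \<open>auto intro: bump_laplacian_bound[of 4, simplified]\<close>)
  moreover have "(\<integral>x. bump_laplacian 4 (x - 0 :: complex ^ 'n) \<partial>lborel) = 0"
    by (rule integral_bump_laplacian) simp
  ultimately show ?thesis unfolding riesz_mass_def by simp
qed

end

section \<open>The exceptional balls\<close>

lemma bump_le: "bump r x \<le> r ^ 6"
proof -
  have "bump r x \<le> (r\<^sup>2) ^ 3" unfolding bump_def using gap_nonneg gap_le by (intro power_mono)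
  thus ?thesis by (simp flip: power_mult)
qed

text \<open>
  The bumps, normalised to height \<open>1\<close>, have disjoint supports in the ball of radius \<open>2\<close>, where
  \<open>bump 4\<close> is at least \<open>(4\<^sup>2 - 2\<^sup>2)\<^sup>3 = 12\<^sup>3\<close>.
\<close>
lemma sum_disjoint_bumps_le:
  fixes F :: "(complex ^ 'n) set"
  assumes F: "finite F" "\<And>z. z \<in> F \<Longrightarrow> norm z \<le> 1" "\<And>z. z \<in> F \<Longrightarrow> 0 < r z \<and> r z \<le> 1"
    and disj: "pairwise (\<lambda>z w. disjnt (cball z (r z)) (cball w (r w))) F"
  shows "(\<Sum>z\<in>F. bump (r z) (x - z) / r z ^ 6) \<le> bump 4 x / 12 ^ 3"
proof (cases "\<exists>z\<in>F. x \<in> ball z (r z)")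
  case False
  hence "bump (r z) (x - z) = 0" if "z \<in> F" for z
    using gap_eq_0[of "r z" "x - z"] that F(3)[of z] by (auto simp: bump_def dist_norm norm_minus_commute)
  thus ?thesis by (simp add: bump_def gap_nonneg)
next
  case True
  then obtain z where z: "z \<in> F" "x \<in> ball z (r z)" by blast
  have "bump (r w) (x - w) = 0" if "w \<in> F - {z}" for w
  proof -
    have "disjnt (cball z (r z)) (cball w (r w))" using disj z(1) that by (auto simp: pairwise_def)
    moreover have "x \<in> cball z (r z)" using z(2) by simp
    ultimately have "x \<notin> cball w (r w)" unfolding disjnt_iff by blast
    hence "x \<notin> ball w (r w)" by auto
    thus ?thesis using gap_eq_0[of "r w" "x - w"] that F(3)[of w] by (auto simp: bump_def dist_norm norm_minus_commute)
  qed
  hence "(\<Sum>z\<in>F. bump (r z) (x - z) / r z ^ 6) = bump (r z) (x - z) / r z ^ 6"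
    using F(1) z(1) by (subst sum.remove[of _ z]) auto
  also have "\<dots> \<le> 1" using bump_le[of "r z" "x - z"] F(3)[OF z(1)] by simp
  also have "1 \<le> bump 4 x / 12 ^ 3"
  proof -
    have "norm x \<le> norm (x - z) + norm z" by norm
    hence "norm x \<le> 2" using z F(2,3)[OF z(1)] by (simp add: dist_norm norm_minus_commute)
    hence "(norm x)\<^sup>2 \<le> 2\<^sup>2" by (intro power_mono) auto
    hence "12 \<le> gap 4 x" by (simp add: gap_def)
    hence "12 ^ 3 \<le> bump 4 x" unfolding bump_def by (intro power_mono) auto
    thus ?thesis by simp
  qed
  finally show ?thesis .
qed

context bounded_psh
begin

lemma sum_riesz_mass_disjoint_le:
  fixes F :: "(complex ^ 'n) set"
  assumes F: "finite F" "\<And>z. z \<in> F \<Longrightarrow> norm z \<le> 1" "\<And>z. z \<in> F \<Longrightarrow> 0 < r z \<and> r z \<le> 1"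
    and disj: "pairwise (\<lambda>z w. disjnt (cball z (r z)) (cball w (r w))) F"
  shows "(\<Sum>z\<in>F. riesz_mass z (r z) / r z ^ 6) \<le> riesz_mass 0 4 / 12 ^ 3"
proof -
  \<comment> \<open>The index \<open>None\<close> stands for the large bump, which enters with a positive sign.\<close>
  let ?I = "insert None (Some ` F)"
  let ?c = "case_option (1 / 12 ^ 3) (\<lambda>z. - 1 / r z ^ 6)"
  let ?r = "case_option 4 r" and ?a = "case_option 0 (\<lambda>z. z)"
  have split: "(\<Sum>i\<in>?I. f i) = f None + (\<Sum>z\<in>F. f (Some z))" for f :: "_ \<Rightarrow> real"
    using F(1) by (subst sum.insert) (auto simp: sum.reindex)
  have "0 \<le> (\<Sum>i\<in>?I. ?c i * riesz_mass (?a i) (?r i))"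
  proof (rule riesz_mass_sum_nonneg)
    show "0 \<le> (\<Sum>i\<in>?I. ?c i * bump (?r i) (x - ?a i))" for x
      unfolding split using sum_disjoint_bumps_le[OF F disj, of x] by (simp add: sum_negf)
    show "0 < ?r i" if "i \<in> ?I" for i using that F(3) by auto
  qed (use F(1) in auto)
  thus ?thesis unfolding split by (simp add: sum_negf)
qed

text \<open>
  A point is bad if the growth condition fails at some scale \<open>r \<le> \<delta>\<close>; Vitali's covering lemma is applied to the
  balls of one such radius around each bad point.
\<close>
lemma exceptional_balls:
  assumes \<delta>: "0 < \<delta>" "\<delta> \<le> 1" and \<alpha>: "0 < \<alpha>" and A: "0 < A"
  obtains J :: "nat set" and c :: "nat \<Rightarrow> complex ^ 'n" and \<rho> :: "nat \<Rightarrow> real"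
  where "\<And>j. j \<in> J \<Longrightarrow> 0 < \<rho> j \<and> \<rho> j \<le> 5 * \<delta>"
    and "(\<lambda>j. \<rho> j powr (2 * real CARD('n) - 2 + \<alpha>)) summable_on J"
    and "(\<Sum>\<^sub>\<infinity>j\<in>J. \<rho> j powr (2 * real CARD('n) - 2 + \<alpha>)) \<le> 5 powr (2 * real CARD('n) - 2 + \<alpha>) * (riesz_mass 0 4 / A)"
    and "\<And>z. z \<in> cball 0 1 \<Longrightarrow> z \<notin> (\<Union>j\<in>J. ball (c j) (\<rho> j)) \<Longrightarrow>
           kernel_mean z \<delta> - 2 / 3 * A * \<delta> powr \<alpha> / \<alpha> \<le> kernel_mass TYPE('n) * v z"
proof -
  let ?p = "2 * real CARD('n) - 2 + \<alpha>"
  define Bad where "Bad = {z \<in> cball 0 1. \<exists>r. 0 < r \<and> r \<le> \<delta> \<and> A * r powr (2 * real CARD('n) + 4 + \<alpha>) < riesz_mass z r}"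
  have good: "kernel_mean z \<delta> - 2 / 3 * A * \<delta> powr \<alpha> / \<alpha> \<le> kernel_mass TYPE('n) * v z" if "z \<in> cball 0 1" "z \<notin> Bad" for z
    using that \<delta> \<alpha> A by (intro lower_bound_of_riesz_mass_decay) (force simp: Bad_def not_less)+
  have "\<forall>z\<in>Bad. \<exists>r. 0 < r \<and> r \<le> \<delta> \<and> A * r powr (2 * real CARD('n) + 4 + \<alpha>) < riesz_mass z r"
    by (auto simp: Bad_def)
  then obtain r where r: "\<And>z. z \<in> Bad \<Longrightarrow> 0 < r z \<and> r z \<le> \<delta>"
     "\<And>z. z \<in> Bad \<Longrightarrow> A * r z powr (2 * real CARD('n) + 4 + \<alpha>) < riesz_mass z (r z)" by metis
  obtain S where S: "countable S" "S \<subseteq> Bad"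
     "pairwise (\<lambda>i j. disjnt (cball i (r i)) (cball j (r j))) S"
     "\<And>i. i \<in> Bad \<Longrightarrow> \<exists>j. j \<in> S \<and> \<not> disjnt (cball i (r i)) (cball j (r j)) \<and> cball i (r i) \<subseteq> ball j (5 * r j)"
    using Vitali_covering_lemma_cballs_balls[of Bad r \<delta> "\<lambda>z. z"] r(1) by blast
  have S': "\<And>z. z \<in> S \<Longrightarrow> 0 < r z \<and> r z \<le> \<delta>" "\<And>z. z \<in> S \<Longrightarrow> norm z \<le> 1"
    using S(2) r(1) by (auto simp: Bad_def)
  let ?f = "\<lambda>z. (5 * r z) powr ?p"
  have fin: "sum ?f F \<le> 5 powr ?p * (riesz_mass 0 4 / A)" if F: "F \<subseteq> S" "finite F" for F
  proof -
    have "A * r z powr ?p \<le> riesz_mass z (r z) / r z ^ 6" if "z \<in> F" for z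
    proof -
      have rz: "0 < r z" using that F S' by auto
      have "A * r z powr ?p = A * r z powr (2 * real CARD('n) + 4 + \<alpha>) / r z ^ 6"
        using powr_realpow[OF rz, of 6] powr_diff[of "r z" "2 * real CARD('n) + 4 + \<alpha>" 6] by (simp add: algebra_simps)
      also have "\<dots> \<le> riesz_mass z (r z) / r z ^ 6"
        using r(2)[of z] that F S(2) rz by (intro divide_right_mono) auto
      finally show ?thesis .
    qed
    hence "(\<Sum>z\<in>F. A * r z powr ?p) \<le> (\<Sum>z\<in>F. riesz_mass z (r z) / r z ^ 6)" by (intro sum_mono)
    also have "\<dots> \<le> riesz_mass 0 4 / 12 ^ 3"
    proof (rule sum_riesz_mass_disjoint_le[OF F(2)])
      show "pairwise (\<lambda>z w. disjnt (cball z (r z)) (cball w (r w))) F"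
        using S(3) F(1) pairwise_subset by blast
      show "norm z \<le> 1" "0 < r z \<and> r z \<le> 1" if "z \<in> F" for z using S'[of z] that F(1) \<delta> by auto
    qed
    also have "\<dots> \<le> riesz_mass 0 4"
    proof -
      have "0 \<le> (\<Sum>i\<in>{()}. 1 * riesz_mass 0 4)" by (rule riesz_mass_sum_nonneg) (simp_all add: bump_def gap_nonneg)
      thus ?thesis by simp
    qed
    finally have "A * (\<Sum>z\<in>F. r z powr ?p) \<le> riesz_mass 0 4" by (simp add: sum_distrib_left)
    hence "(\<Sum>z\<in>F. r z powr ?p) \<le> riesz_mass 0 4 / A" using A by (simp add: pos_le_divide_eq mult.commute)
    hence "5 powr ?p * (\<Sum>z\<in>F. r z powr ?p) \<le> 5 powr ?p * (riesz_mass 0 4 / A)" by (intro mult_left_mono) auto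
    moreover have "sum ?f F = 5 powr ?p * (\<Sum>z\<in>F. r z powr ?p)"
      unfolding sum_distrib_left using F S' by (intro sum.cong) (auto simp: powr_mult)
    ultimately show ?thesis by (simp only:)
  qed
  have summ: "?f summable_on S"
    by (rule nonneg_bdd_above_summable_on) (auto intro!: bdd_aboveI2 fin)
  have inf: "infsum ?f S \<le> 5 powr ?p * (riesz_mass 0 4 / A)"
    using summ fin by (intro infsum_le_finite_sums) auto
  define J c where "J = to_nat_on S ` S" and "c = from_nat_into S"
  have c: "c (to_nat_on S z) = z" if "z \<in> S" for z using that S(1) by (simp add: c_def)
  have inj: "inj_on (to_nat_on S) S" using S(1) by (rule inj_on_to_nat_on)
  show thesis
  proof (rule that[of J "\<lambda>j. 5 * r (c j)" c])
    show "0 < 5 * r (c j) \<and> 5 * r (c j) \<le> 5 * \<delta>" if "j \<in> J" for j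
      using that c S' by (auto simp: J_def)
    have eq: "?f summable_on S \<longleftrightarrow> ((\<lambda>j. (5 * r (c j)) powr ?p) \<circ> to_nat_on S) summable_on S"
      by (rule summable_on_cong) (simp add: c)
    show "(\<lambda>j. (5 * r (c j)) powr ?p) summable_on J"
      unfolding J_def summable_on_reindex[OF inj] using summ eq by blast
    have "infsum ((\<lambda>j. (5 * r (c j)) powr ?p) \<circ> to_nat_on S) S = infsum ?f S"
      by (rule infsum_cong) (simp add: c)
    thus "(\<Sum>\<^sub>\<infinity>j\<in>J. (5 * r (c j)) powr ?p) \<le> 5 powr ?p * (riesz_mass 0 4 / A)"
      unfolding J_def infsum_reindex[OF inj] using inf by simp
    show "kernel_mean z \<delta> - 2 / 3 * A * \<delta> powr \<alpha> / \<alpha> \<le> kernel_mass TYPE('n) * v z"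
      if "z \<in> cball 0 1" "z \<notin> (\<Union>j\<in>J. ball (c j) (5 * r (c j)))" for z
    proof (rule good[OF that(1)])
      show "z \<notin> Bad"
      proof
        assume z: "z \<in> Bad"
        from S(4)[OF z] obtain w where "w \<in> S" "cball z (r z) \<subseteq> ball w (5 * r w)" by blast
        moreover have "z \<in> cball z (r z)" using r(1)[OF z] by simp
        ultimately have "z \<in> ball w (5 * r w)" "w \<in> S" by blast+
        thus False using that(2) c by (force simp: J_def)
      qed
    qed
  qed
qed

text \<open>
  The parameter \<open>A\<close> is chosen such that \<open>2 / 3 * A * \<delta>\<^sup>\<alpha> / \<alpha>\<close>, the loss permitted by the growth condition, is
  \<open>(\<nu> - 1) ln (10 / \<eta>)\<close> times the kernel mass. Then \<open>1 / A\<close> carries a factor \<open>1 / ln (10 / \<eta>)\<close>, and the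
  hypothesis on \<open>Q\<close> says that this factor absorbs all constants. The radius \<open>\<delta> = \<eta> / 10\<close> leaves room
  for the fivefold enlargement with a strict inequality.
\<close>
lemma lower_bound_off_small_balls:
  fixes \<nu> \<eta> \<alpha> M :: real
  defines "n \<equiv> real CARD('n)"
  defines "C1 \<equiv> 4 * 9 ^ CARD('n) * ln 4"
    and "Q \<equiv> 5 powr (2 * n) * (4 * ((6 + 3 * n) * 4 ^ 4) * 9 ^ (2 * CARD('n)) * ln 10)"
  assumes growth: "\<And>x. v x \<le> log_plus (norm x) + M"
    and \<nu>: "1 < \<nu>" and \<eta>: "0 < \<eta>" "\<eta> < 1" "Q / (\<nu> - 1) < ln (10 / \<eta>)" and \<alpha>: "0 < \<alpha>" "\<alpha> \<le> 2"
  obtains J :: "nat set" and c :: "nat \<Rightarrow> complex ^ 'n" and \<rho> :: "nat \<Rightarrow> real"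
  where "\<And>j. j \<in> J \<Longrightarrow> 0 < \<rho> j \<and> \<rho> j < \<eta>"
    and "(\<lambda>j. \<rho> j powr (2 * n - 2 + \<alpha>)) summable_on J"
    and "(\<Sum>\<^sub>\<infinity>j\<in>J. \<rho> j powr (2 * n - 2 + \<alpha>)) < \<eta> powr \<alpha> / \<alpha>"
    and "\<And>z w. z \<in> cball 0 1 \<Longrightarrow> z \<notin> (\<Union>j\<in>J. ball (c j) (\<rho> j)) \<Longrightarrow> w \<in> cball 0 1 \<Longrightarrow>
           v w - \<nu> * ln (20 * exp C1 / \<eta>) \<le> v z"
proof -
  let ?k = "kernel_mass TYPE('n)"
  define \<delta> where "\<delta> = \<eta> / 10"
  define l where "l = ln (10 / \<eta>)"
  have k: "0 < ?k" by (rule kernel_mass_pos)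
  have \<delta>: "0 < \<delta>" "\<delta> \<le> 1" "5 * \<delta> < \<eta>" "1 / \<delta> = 10 / \<eta>" using \<eta> by (auto simp: \<delta>_def)
  have l: "0 < l" unfolding l_def using \<eta> by (intro ln_gt_zero) auto
  define A where "A = 3 / 2 * ?k * \<alpha> * (\<nu> - 1) * l / \<delta> powr \<alpha>"
  have \<delta>\<alpha>: "0 < \<delta> powr \<alpha>" using \<delta> by simp
  have A: "0 < A" using k \<alpha> \<nu> l \<delta>\<alpha> by (simp add: A_def)
  obtain J :: "nat set" and c :: "nat \<Rightarrow> complex ^ 'n" and \<rho> :: "nat \<Rightarrow> real" where
    J: "\<And>j. j \<in> J \<Longrightarrow> 0 < \<rho> j \<and> \<rho> j \<le> 5 * \<delta>"
     "(\<lambda>j. \<rho> j powr (2 * n - 2 + \<alpha>)) summable_on J"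
     "(\<Sum>\<^sub>\<infinity>j\<in>J. \<rho> j powr (2 * n - 2 + \<alpha>)) \<le> 5 powr (2 * n - 2 + \<alpha>) * (riesz_mass 0 4 / A)"
     "\<And>z. z \<in> cball 0 1 \<Longrightarrow> z \<notin> (\<Union>j\<in>J. ball (c j) (\<rho> j)) \<Longrightarrow> kernel_mean z \<delta> - 2 / 3 * A * \<delta> powr \<alpha> / \<alpha> \<le> ?k * v z"
    by (rule exceptional_balls[OF \<delta>(1,2) \<alpha>(1) A, folded n_def]) blast
  show thesis
  proof (rule that[OF _ J(2)])
    show "0 < \<rho> j \<and> \<rho> j < \<eta>" if "j \<in> J" for j using J(1)[OF that] \<delta>(3) by linarith
    show "(\<Sum>\<^sub>\<infinity>j\<in>J. \<rho> j powr (2 * n - 2 + \<alpha>)) < \<eta> powr \<alpha> / \<alpha>"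
    proof -
      define c2 where "c2 = 4 * ((6 + 3 * n) * 4 ^ 4) * 9 ^ (2 * CARD('n)) * ln 10"
      have riesz_mass: "riesz_mass 0 4 \<le> c2 * ?k" using riesz_mass_upper_bound[OF growth] by (simp add: c2_def n_def mult_ac)
      have "5 powr (2 * n - 2 + \<alpha>) * (riesz_mass 0 4 / A) \<le> 5 powr (2 * n) * (c2 * ?k / A)"
      proof (rule mult_mono)
        show "(5::real) powr (2 * n - 2 + \<alpha>) \<le> 5 powr (2 * n)" using \<alpha> by (intro powr_mono) auto
        show "riesz_mass 0 4 / A \<le> c2 * ?k / A" using riesz_mass A by (intro divide_right_mono) auto
        have "0 \<le> (\<Sum>i\<in>{()}. 1 * riesz_mass 0 4)" by (rule riesz_mass_sum_nonneg) (simp_all add: bump_def gap_nonneg)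
        thus "0 \<le> riesz_mass 0 4 / A" using A by simp
      qed auto
      also have "\<dots> = Q * ?k / A" by (simp add: Q_def c2_def)
      also have "\<dots> = 2 / 3 * (Q / (\<nu> - 1) / l) * (\<delta> powr \<alpha> / \<alpha>)"
      proof -
        have "Q * k / (3 / 2 * k * a * m * l / d) = 2 / 3 * (Q / m / l) * (d / a)"
          if "k \<noteq> 0" "a \<noteq> 0" "m \<noteq> 0" "l \<noteq> 0" "d \<noteq> 0" for k a m l d :: real
          using that by (simp add: field_simps)
        note eq = this
        show ?thesis unfolding A_def by (rule eq) (use k \<nu> l \<alpha> \<delta>\<alpha> in auto)
      qed
      also have "\<dots> < 1 * (\<delta> powr \<alpha> / \<alpha>)"
      proof (rule mult_strict_right_mono)
        have "Q / (\<nu> - 1) < l" using \<eta>(3) by (simp only: l_def)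
        hence "Q / (\<nu> - 1) / l < 1" by (simp only: divide_less_eq_1_pos[OF l])
        moreover have "0 \<le> Q" unfolding Q_def n_def by (intro mult_nonneg_nonneg) auto
        hence "0 \<le> Q / (\<nu> - 1) / l" using \<nu> l by simp
        ultimately show "2 / 3 * (Q / (\<nu> - 1) / l) < 1" by linarith
        show "0 < \<delta> powr \<alpha> / \<alpha>" using \<delta>\<alpha> \<alpha> by simp
      qed
      also have "\<dots> \<le> \<eta> powr \<alpha> / \<alpha>"
        using \<delta> \<alpha> by (simp add: divide_right_mono powr_mono2)
      finally show ?thesis using J(3) by simp
    qed
    show "v w - \<nu> * ln (20 * exp C1 / \<eta>) \<le> v z"
      if "z \<in> cball 0 1" "z \<notin> (\<Union>j\<in>J. ball (c j) (\<rho> j))" "w \<in> cball 0 1" for z w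
    proof -
      have C1: "0 \<le> C1" by (simp add: C1_def)
      have ln2: "ln (2 / \<delta>) = ln 2 + l"
        using ln_mult_pos[of 2 "10 / \<eta>"] \<eta> by (simp add: \<delta>_def l_def)
      have "ln (20 * exp C1 / \<eta>) = ln (10 / \<eta> * (2 * exp C1))" by simp
      also have "\<dots> = l + ln 2 + C1" using \<eta> by (subst ln_mult_pos) (auto simp: l_def ln_mult_pos)
      finally have lnC: "ln (20 * exp C1 / \<eta>) = l + ln 2 + C1" .
      have "?k * (v w - (ln 2 + l) - C1) - ?k * ((\<nu> - 1) * l) \<le> kernel_mean z \<delta> - 2 / 3 * A * \<delta> powr \<alpha> / \<alpha>"
      proof (rule diff_mono)
        show "?k * (v w - (ln 2 + l) - C1) \<le> kernel_mean z \<delta>"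
          using kernel_mean_lower_bound[OF growth \<delta>(1,2), of z w] that by (simp add: ln2 C1_def)
        show "2 / 3 * A * \<delta> powr \<alpha> / \<alpha> \<le> ?k * ((\<nu> - 1) * l)" using \<delta>\<alpha> \<alpha> by (simp add: A_def)
      qed
      also have "\<dots> \<le> ?k * v z" by (rule J(4)[OF that(1,2)])
      finally have "?k * (v w - \<nu> * l - (ln 2 + C1)) \<le> ?k * v z" by (simp add: algebra_simps)
      hence "v w - \<nu> * l - (ln 2 + C1) \<le> v z" using k by simp
      moreover have "1 * (ln 2 + C1) \<le> \<nu> * (ln 2 + C1)" using \<nu> C1 by (intro mult_right_mono) auto
      ultimately show ?thesis unfolding lnC by (simp add: algebra_simps)
    qed
  qed
qed

end

section \<open>Truncation and rescaling\<close>

text \<open>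
  Truncating from below raises the positive part of \<open>f\<close> and lowers the negative part, so the extended
  circle mean of \<open>f\<close> is at most the integral of the truncated function. Where the truncation is
  active at the centre, the inequality is trivial.
\<close>
lemma truncated_circle_submean:
  fixes f :: "complex \<Rightarrow> ereal"
  assumes f: "subharmonic f" and B: "\<And>\<theta>. f (cis \<theta>) \<le> ereal B"
  shows "2 * pi * real_of_ereal (max (f 0) (ereal K))
       \<le> (LINT \<theta>:{0..2*pi}|lborel. real_of_ereal (max (f (cis \<theta>)) (ereal K)))"
proof -
  define g where "g \<theta> = real_of_ereal (max (f (cis \<theta>)) (ereal K))" for \<theta>
  have g: "ereal (g \<theta>) = max (f (cis \<theta>)) (ereal K)" for \<theta>
    using B[of \<theta>] unfolding g_def by (cases "f (cis \<theta>)") (auto simp: max_def)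
  have [measurable]: "f \<in> borel_measurable borel"
    using f by (intro borel_measurableI_less) (auto simp: subharmonic_def usc_def)
  have [measurable]: "g \<in> borel_measurable borel" unfolding g_def by measurable
  have bound: "\<bar>g \<theta>\<bar> \<le> \<bar>B\<bar> + \<bar>K\<bar>" for \<theta>
  proof -
    have "ereal (g \<theta>) \<le> ereal (\<bar>B\<bar> + \<bar>K\<bar>)" unfolding g
      by (rule max.boundedI, rule order_trans[OF B]) auto
    moreover have "ereal K \<le> ereal (g \<theta>)" unfolding g by simp
    ultimately show ?thesis by simp
  qed
  have int: "integrable lborel (\<lambda>\<theta>. indicator {0..2*pi} \<theta> * g \<theta>)"
    by (rule integrable_bounded_support[where a=pi and R=pi and B="\<bar>B\<bar> + \<bar>K\<bar>"])
       (use bound in \<open>auto simp: indicator_def dist_real_def intro: add_nonneg_nonneg\<close>)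
  let ?I = "LINT \<theta>:{0..2*pi}|lborel. g \<theta>"
  have "K \<le> g \<theta>" for \<theta> using g[of \<theta>] by (metis ereal_less_eq(3) max.cobounded2)
  moreover have "set_integrable lborel {0..2*pi} g" using int by (simp add: set_integrable_def)
  ultimately have "(LINT \<theta>:{0..2*pi}|lborel. K) \<le> ?I"
    by (intro set_integral_mono) (auto intro: set_integrable_circle)
  hence K: "2 * pi * K \<le> ?I" by (simp only: circle_integral_const)
  let ?P = "\<integral>\<^sup>+\<theta>\<in>{0..2*pi}. e2ennreal (f (cis \<theta>)) \<partial>lborel" and ?N = "\<integral>\<^sup>+\<theta>\<in>{0..2*pi}. e2ennreal (- f (cis \<theta>)) \<partial>lborel"
  let ?P' = "\<integral>\<^sup>+\<theta>. ennreal (indicator {0..2*pi} \<theta> * g \<theta>) \<partial>lborel"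
  let ?N' = "\<integral>\<^sup>+\<theta>. ennreal (- (indicator {0..2*pi} \<theta> * g \<theta>)) \<partial>lborel"
  have fin: "?P' \<noteq> \<infinity>" "?N' \<noteq> \<infinity>"
    using int unfolding real_integrable_def by auto
  have "?I = enn2real ?P' - enn2real ?N'"
    unfolding set_lebesgue_integral_def real_scaleR_def by (rule real_lebesgue_integral_def[OF int])
  hence I: "ereal ?I = enn2ereal ?P' - enn2ereal ?N'"
    using fin by (cases ?P'; cases ?N') (auto simp: enn2ereal_ennreal)
  have P: "?P \<le> ?P'"
  proof (rule nn_integral_mono)
    fix \<theta>
    have "e2ennreal (f (cis \<theta>)) \<le> e2ennreal (ereal (g \<theta>))" unfolding g by (intro e2ennreal_mono) simp
    thus "e2ennreal (f (cis \<theta>)) * indicator {0..2*pi} \<theta> \<le> ennreal (indicator {0..2*pi} \<theta> * g \<theta>)"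
      by (auto simp: indicator_def)
  qed
  have N: "?N' \<le> ?N"
  proof (rule nn_integral_mono)
    fix \<theta>
    have "e2ennreal (ereal (- g \<theta>)) \<le> e2ennreal (- f (cis \<theta>))"
      using g[of \<theta>] by (intro e2ennreal_mono) (metis ereal_minus_le_minus max.cobounded1 uminus_ereal.simps(1))
    thus "ennreal (- (indicator {0..2*pi} \<theta> * g \<theta>)) \<le> e2ennreal (- f (cis \<theta>)) * indicator {0..2*pi} \<theta>"
      by (auto simp: indicator_def)
  qed
  have "f 0 \<le> circle_mean f 0 1" using f by (simp add: subharmonic_def)
  also have "\<dots> = (enn2ereal ?P - enn2ereal ?N) / ereal (2 * pi)" by (simp add: circle_mean_def)
  also have "\<dots> \<le> ereal ?I / ereal (2 * pi)"
    unfolding I using P N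
    by (intro ereal_divide_right_mono ereal_minus_mono) (auto simp: less_eq_ennreal.rep_eq)
  finally have F: "f 0 \<le> ereal (?I / (2 * pi))" by simp
  have "max (f 0) (ereal K) \<le> ereal (?I / (2 * pi))" using F K by (simp add: field_simps)
  moreover have "max (f 0) (ereal K) \<noteq> -\<infinity>" by (cases "f 0") (auto simp: max_def)
  ultimately have "real_of_ereal (max (f 0) (ereal K)) \<le> ?I / (2 * pi)"
    using real_of_ereal_positive_mono by (cases "max (f 0) (ereal K)") auto
  thus ?thesis by (simp add: g_def field_simps)
qed

definition truncation :: "((complex ^ 'n) \<Rightarrow> ereal) \<Rightarrow> real \<Rightarrow> real \<Rightarrow> complex ^ 'n \<Rightarrow> real" where
  "truncation V R K x = real_of_ereal (max (V (R *\<^sub>R x)) (ereal K))"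

lemma ereal_truncation:
  assumes "V (R *\<^sub>R x) < \<infinity>"
  shows "ereal (truncation V R K x) = max (V (R *\<^sub>R x)) (ereal K)"
  using assms by (cases "V (R *\<^sub>R x)") (auto simp: truncation_def max_def)

lemma bounded_psh_truncation:
  fixes V :: "(complex ^ 'n) \<Rightarrow> ereal"
  assumes V: "V \<in> lelong_class"
  shows "bounded_psh (truncation V R K)"
proof
  have usc: "open {x. V x < c}" for c using V by (auto simp: lelong_class_def PSH_def usc_def)
  have lt: "V x < \<infinity>" for x using V by (auto simp: lelong_class_def PSH_def)
  have sub: "subharmonic (\<lambda>t. V (a + t *s b))" for a b using V by (auto simp: lelong_class_def PSH_def)
  obtain M where M: "V x \<le> ereal (log_plus (norm x) + M)" for x using V by (auto simp: lelong_class_def)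
  note T = ereal_truncation[where V=V and R=R and K=K, OF lt]
  show "open {x. truncation V R K x < c}" for c
  proof (cases "K < c")
    case True
    have "{x. truncation V R K x < c} = (\<lambda>x. R *\<^sub>R x) -` {x. V x < ereal c}"
      using T True by (auto simp flip: ereal_less_eq(3) less_ereal.simps(1))
    moreover have "open ((\<lambda>x. R *\<^sub>R x) -` {x. V x < ereal c})"
      by (intro open_vimage usc continuous_intros)
    ultimately show ?thesis by simp
  next
    case False
    hence "{x. truncation V R K x < c} = {}"
      using T by (auto simp flip: ereal_less_eq(3) less_ereal.simps(1) simp: not_less)
    thus ?thesis by (metis open_empty)
  qed
  show "\<exists>c. \<forall>x. c \<le> truncation V R K x"
    using T by (intro exI[of _ K]) (metis ereal_less_eq(3) max.cobounded2)
  show "2 * pi * truncation V R K a \<le> (LINT \<theta>:{0..2*pi}|lborel. truncation V R K (a + cis \<theta> *s b))" for a b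
  proof -
    let ?f = "\<lambda>t. V (R *\<^sub>R a + t *s (R *\<^sub>R b))"
    have eq: "R *\<^sub>R a + t *s (R *\<^sub>R b) = R *\<^sub>R (a + t *s b)" for t
      by (simp add: vec_eq_iff algebra_simps)
    have "?f (cis \<theta>) \<le> ereal (log_plus (norm (R *\<^sub>R a) + norm (R *\<^sub>R b)) + M)" for \<theta>
    proof -
      have "norm (R *\<^sub>R a + cis \<theta> *s (R *\<^sub>R b)) \<le> norm (R *\<^sub>R a) + norm (R *\<^sub>R b)"
        using norm_triangle_ineq[of "R *\<^sub>R a" "cis \<theta> *s (R *\<^sub>R b)"] by (simp add: norm_scalar_mult)
      hence "log_plus (norm (R *\<^sub>R a + cis \<theta> *s (R *\<^sub>R b))) \<le> log_plus (norm (R *\<^sub>R a) + norm (R *\<^sub>R b))"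
        unfolding log_plus_def by (intro ln_mono) auto
      thus ?thesis using order_trans[OF M] by (metis add_right_mono ereal_less_eq(3))
    qed
    from truncated_circle_submean[OF sub this, of K] show ?thesis
      unfolding truncation_def eq by simp
  qed
qed

lemma truncation_growth:
  fixes V :: "(complex ^ 'n) \<Rightarrow> ereal"
  assumes V: "V \<in> lelong_class" and R: "1 \<le> R"
  obtains M where "\<And>x. truncation V R K x \<le> log_plus (norm x) + M"
proof -
  have lt: "V x < \<infinity>" for x using V by (auto simp: lelong_class_def PSH_def)
  obtain M where M: "V x \<le> ereal (log_plus (norm x) + M)" for x using V by (auto simp: lelong_class_def)
  have "truncation V R K x \<le> log_plus (norm x) + (ln R + \<bar>M\<bar> + \<bar>K\<bar>)" for x
  proof -
    have "R * norm x \<le> R * max 1 (norm x)" using R by (intro mult_left_mono) auto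
    moreover have "1 * 1 \<le> R * max 1 (norm x)" using R by (intro mult_mono) auto
    ultimately have "max 1 (R * norm x) \<le> R * max 1 (norm x)" by simp
    hence "log_plus (norm (R *\<^sub>R x)) \<le> ln (R * max 1 (norm x))"
      unfolding log_plus_def using R by (intro ln_mono) auto
    also have "\<dots> = ln R + log_plus (norm x)" unfolding log_plus_def using R by (intro ln_mult_pos) auto
    finally have "V (R *\<^sub>R x) \<le> ereal (log_plus (norm x) + (ln R + \<bar>M\<bar> + \<bar>K\<bar>))"
      by (intro order_trans[OF M]) simp
    moreover have "0 \<le> log_plus (norm x)" "0 \<le> ln R" using R by (auto simp: log_plus_def)
    hence "ereal K \<le> ereal (log_plus (norm x) + (ln R + \<bar>M\<bar> + \<bar>K\<bar>))" by simp
    ultimately have "ereal (truncation V R K x) \<le> ereal (log_plus (norm x) + (ln R + \<bar>M\<bar> + \<bar>K\<bar>))"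
      unfolding ereal_truncation[OF lt] by (rule max.boundedI)
    thus ?thesis by simp
  qed
  thus thesis by (rule that)
qed

theorem theorem6p2:
  fixes \<nu> :: real
  assumes "\<nu> > 1"
  shows "\<exists>C \<eta>\<^sub>0. 0 < C \<and> 0 < \<eta>\<^sub>0 \<and> \<eta>\<^sub>0 < 1 \<and>
    (\<forall>\<eta> \<alpha> R :: real. \<forall>V \<in> (lelong_class :: ((complex ^ 'n) \<Rightarrow> ereal) set).
      0 < \<eta> \<longrightarrow> \<eta> \<le> \<eta>\<^sub>0 \<longrightarrow> 0 < \<alpha> \<longrightarrow> \<alpha> \<le> 2 \<longrightarrow> 1 \<le> R \<longrightarrow>
      (\<exists>(J :: nat set) (c :: nat \<Rightarrow> complex ^ 'n) (r :: nat \<Rightarrow> real).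
        (\<forall>j\<in>J. 0 < r j \<and> r j < \<eta> * R) \<and>
        (\<lambda>j. r j powr (2 * real CARD('n) - 2 + \<alpha>)) summable_on J \<and>
        (\<Sum>\<^sub>\<infinity>j\<in>J. r j powr (2 * real CARD('n) - 2 + \<alpha>))
          < 9 ^ (CARD('n) - 1) * R powr (2 * real CARD('n) - 2 + \<alpha>) * \<eta> powr \<alpha> / \<alpha> \<and>
        (\<forall>z \<in> cball 0 R - (\<Union>j\<in>J. ball (c j) (r j)).
          V z \<ge> (SUP w\<in>cball 0 R. V w) - ereal (\<nu> * ln (C / \<eta>)))))"
proof -
  define n where "n = real CARD('n)"
  define C where "C = 20 * exp (4 * 9 ^ CARD('n) * ln 4 :: real)"
  define Q where "Q = 5 powr (2 * n) * (4 * ((6 + 3 * n) * 4 ^ 4) * 9 ^ (2 * CARD('n)) * ln 10)"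
  \<comment> \<open>For \<open>\<eta> \<le> \<eta>0\<close>, \<open>ln (10 / \<eta>)\<close> exceeds \<open>Q / (\<nu> - 1)\<close>; the factor \<open>1/2\<close> keeps \<open>\<eta>0\<close> below \<open>1\<close>.\<close>
  define \<eta>0 where "\<eta>0 = exp (- (Q / (\<nu> - 1))) / 2"
  have "0 \<le> Q" unfolding Q_def n_def by (intro mult_nonneg_nonneg) auto
  hence Q: "0 \<le> Q / (\<nu> - 1)" using assms by simp
  have "exp (- (Q / (\<nu> - 1))) \<le> 1" using Q by simp
  hence "\<eta>0 < 1" unfolding \<eta>0_def by linarith
  moreover have "0 < \<eta>0" by (simp add: \<eta>0_def)
  ultimately have \<eta>0: "0 < \<eta>0" "\<eta>0 < 1" by blast+
  show ?thesis unfolding n_def[symmetric]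
  proof (rule exI[of _ C], rule exI[of _ \<eta>0], intro conjI allI ballI impI)
    show "0 < C" "0 < \<eta>0" "\<eta>0 < 1" using \<eta>0 by (auto simp: C_def)
    fix \<eta> \<alpha> R :: real and V :: "(complex ^ 'n) \<Rightarrow> ereal"
    assume V: "V \<in> lelong_class" and \<eta>: "0 < \<eta>" "\<eta> \<le> \<eta>0" and \<alpha>: "0 < \<alpha>" "\<alpha> \<le> 2" and R: "1 \<le> R"
    let ?p = "2 * n - 2 + \<alpha>"
    let ?rhs = "9 ^ (CARD('n) - 1) * R powr ?p * \<eta> powr \<alpha> / \<alpha>"
    let ?S = "SUP w\<in>cball 0 R. V w"
    have rhs: "R powr ?p * (\<eta> powr \<alpha> / \<alpha>) \<le> ?rhs"
      using mult_right_mono[of 1 "9 ^ (CARD('n) - 1)" "R powr ?p * (\<eta> powr \<alpha> / \<alpha>)"] \<alpha> by (simp add: mult.assoc)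
    have rhs0: "0 < ?rhs" using R \<eta> \<alpha> by simp
    have lt: "V x < \<infinity>" for x using V by (auto simp: lelong_class_def PSH_def)
    show "\<exists>(J :: nat set) (c :: nat \<Rightarrow> complex ^ 'n) (r :: nat \<Rightarrow> real).
        (\<forall>j\<in>J. 0 < r j \<and> r j < \<eta> * R) \<and>
        (\<lambda>j. r j powr ?p) summable_on J \<and> (\<Sum>\<^sub>\<infinity>j\<in>J. r j powr ?p) < ?rhs \<and>
        (\<forall>z \<in> cball 0 R - (\<Union>j\<in>J. ball (c j) (r j)). ?S - ereal (\<nu> * ln (C / \<eta>)) \<le> V z)"
    proof (cases "?S = -\<infinity>")
      case True
      show ?thesis using rhs0 by (intro exI[of _ "{}"]) (simp add: True)
    next
      case False
      have "?S \<noteq> \<infinity>"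
      proof -
        obtain M where M: "V x \<le> ereal (log_plus (norm x) + M)" for x using V by (auto simp: lelong_class_def)
        have "?S \<le> ereal (log_plus R + M)"
        proof (rule SUP_least)
          fix w :: "complex ^ 'n" assume "w \<in> cball 0 R"
          hence "log_plus (norm w) \<le> log_plus R" unfolding log_plus_def by (intro ln_mono) auto
          thus "V w \<le> ereal (log_plus R + M)" by (intro order_trans[OF M]) simp
        qed
        thus ?thesis by auto
      qed
      with False obtain m where m: "?S = ereal m" by (cases ?S) auto
      define L where "L = m - \<nu> * ln (C / \<eta>)"
      \<comment> \<open>Truncating at \<open>L - 1\<close> rather than \<open>L\<close> ensures that a point with \<open>u \<ge> L\<close> has \<open>V \<ge> L\<close>.\<close>
      define u where "u = truncation V R (L - 1)"
      interpret bounded_psh u unfolding u_def by (rule bounded_psh_truncation[OF V])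
      obtain M where growth: "\<And>x. u x \<le> log_plus (norm x) + M"
        using truncation_growth[OF V R] unfolding u_def by metis
      have big: "Q / (\<nu> - 1) < ln (10 / \<eta>)"
      proof -
        have "10 / \<eta>0 \<le> 10 / \<eta>" using \<eta> by (intro divide_left_mono) auto
        moreover have "exp (Q / (\<nu> - 1)) < 10 / \<eta>0" by (simp add: \<eta>0_def exp_minus field_simps)
        ultimately have "exp (Q / (\<nu> - 1)) < 10 / \<eta>" by linarith
        hence "ln (exp (Q / (\<nu> - 1))) < ln (10 / \<eta>)" using \<eta>(1) by (subst ln_less_cancel_iff) auto
        thus ?thesis by simp
      qed
      have \<eta>1: "\<eta> < 1" using \<eta> \<eta>0 by linarith
      obtain J :: "nat set" and c :: "nat \<Rightarrow> complex ^ 'n" and \<rho> :: "nat \<Rightarrow> real" where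
        J: "\<And>j. j \<in> J \<Longrightarrow> 0 < \<rho> j \<and> \<rho> j < \<eta>" "(\<lambda>j. \<rho> j powr ?p) summable_on J"
          "(\<Sum>\<^sub>\<infinity>j\<in>J. \<rho> j powr ?p) < \<eta> powr \<alpha> / \<alpha>"
          "\<And>z w. z \<in> cball 0 1 \<Longrightarrow> z \<notin> (\<Union>j\<in>J. ball (c j) (\<rho> j)) \<Longrightarrow> w \<in> cball 0 1 \<Longrightarrow> u w - \<nu> * ln (C / \<eta>) \<le> u z"
        unfolding n_def C_def
        by (rule lower_bound_off_small_balls[OF growth assms \<eta>(1) \<eta>1 big[unfolded Q_def n_def] \<alpha>]) blast
      have scale: "(R * \<rho> j) powr ?p = R powr ?p * \<rho> j powr ?p" if "j \<in> J" for j
        using J(1)[OF that] R by (simp add: powr_mult)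
      show ?thesis
      proof (intro exI[of _ J] exI[of _ "\<lambda>j. R *\<^sub>R c j"] exI[of _ "\<lambda>j. R * \<rho> j"] conjI ballI)
        show "0 < R * \<rho> j" "R * \<rho> j < \<eta> * R" if "j \<in> J" for j using J(1)[OF that] R by auto
        have "(\<lambda>j. R powr ?p * \<rho> j powr ?p) summable_on J" by (rule summable_on_cmult_right[OF J(2)])
        thus "(\<lambda>j. (R * \<rho> j) powr ?p) summable_on J" by (subst summable_on_cong[OF scale])
        have "(\<Sum>\<^sub>\<infinity>j\<in>J. (R * \<rho> j) powr ?p) = (\<Sum>\<^sub>\<infinity>j\<in>J. R powr ?p * \<rho> j powr ?p)"
          by (rule infsum_cong[OF scale])
        also have "\<dots> = R powr ?p * (\<Sum>\<^sub>\<infinity>j\<in>J. \<rho> j powr ?p)" by (rule infsum_cmult_right[OF J(2)])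
        also have "\<dots> < R powr ?p * (\<eta> powr \<alpha> / \<alpha>)" using J(3) R by (intro mult_strict_left_mono) auto
        also note rhs
        finally show "(\<Sum>\<^sub>\<infinity>j\<in>J. (R * \<rho> j) powr ?p) < ?rhs" .
        fix z assume z: "z \<in> cball 0 R - (\<Union>j\<in>J. ball (R *\<^sub>R c j) (R * \<rho> j))"
        define y where "y = (1 / R) *\<^sub>R z"
        have zy: "z = R *\<^sub>R y" using R by (simp add: y_def)
        have y: "y \<in> cball 0 1" using z R by (simp add: zy)
        have y': "y \<notin> (\<Union>j\<in>J. ball (c j) (\<rho> j))"
        proof
          assume "y \<in> (\<Union>j\<in>J. ball (c j) (\<rho> j))"
          then obtain j where j: "j \<in> J" "dist (c j) y < \<rho> j" by auto
          have "dist (R *\<^sub>R c j) z = R * dist (c j) y" using R by (simp add: zy dist_norm flip: scaleR_diff_right)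
          thus False using z j R by auto
        qed
        have "L \<le> u y"
        proof (rule ccontr)
          assume less: "\<not> L \<le> u y"
          have "?S \<le> ereal (u y + \<nu> * ln (C / \<eta>))"
          proof (rule SUP_least)
            fix w :: "complex ^ 'n" assume w: "w \<in> cball 0 R"
            have Rw: "R *\<^sub>R ((1 / R) *\<^sub>R w) = w" using R by simp
            have "V w \<le> ereal (u ((1 / R) *\<^sub>R w))"
              unfolding u_def ereal_truncation[OF lt] Rw by simp
            also have "u ((1 / R) *\<^sub>R w) \<le> u y + \<nu> * ln (C / \<eta>)"
              using J(4)[OF y y', of "(1 / R) *\<^sub>R w"] w R by (simp add: divide_le_eq)
            finally show "V w \<le> ereal (u y + \<nu> * ln (C / \<eta>))" by simp
          qed
          thus False using less by (simp add: m L_def)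
        qed
        hence "ereal L \<le> ereal (u y)" by simp
        also have "ereal (u y) = max (V z) (ereal (L - 1))"
          unfolding u_def zy by (rule ereal_truncation[OF lt])
        finally have "ereal L \<le> max (V z) (ereal (L - 1))" .
        hence "ereal L \<le> V z" by (auto simp: max_def split: if_splits)
        thus "?S - ereal (\<nu> * ln (C / \<eta>)) \<le> V z" by (simp add: m L_def)
      qed
    qed
  qed
qed

end
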